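(* Let $m\in\mathbb{N}$, $n=2^m-1$, let $f(x)\in GF(2)[x]$ be a primitive polynomial of degree $m$, let $\varphi$ be a Golomb sequence of length $n$ generated by $f$, and let $$\mathbf{A}_n=\Big\{\tfrac{1}{2\sqrt{n}}(-1)^{\varphi(i-j)+\varphi(j-i)}\Big\}_{i,j=0}^{n-1}.$$ Then the conditional Kolmogorov complexity of $\mathbf{A}_n$ satisfies $$\mathcal{KC}(\mathbf{A}_n\mid n)=\mathcal{KC}(\varphi\mid n)+c\ \le\ 2\log_2(n+1)-1+c\ \asymp\ 2\log_2 n,$$ where $c$ stands for an additive constant (bounded independently of $n$, $f$ and $\varphi$) and $\asymp$ denotes asymptotic equivalence as $n\to\infty$.
   Context: Golomb sequences. Let $f(x)\in GF(2)[x]$ be primitive of degree $m$, $n=2^m-1$, $h(x)=\frac{x^n-1}{f(x)}$. Identify a word $\mathbf{c}=(c_0,\dots,c_{n-1})\in GF(2)^n$ with the polynomial $\mathbf{c}(x)=\sum_{i=0}^{n-1}c_ix^i$. The simplex code is $\mathcal{C}=\{\mathbf{c}\in GF(2)^n : h(x)\mid\mathbf{c}(x)\}$; its non-zero codewords are all cyclic shifts of each other and are called Golomb sequences. A Golomb sequence $\varphi=(\varphi(0),\dots,\varphi(n-1))$ is regarded as an $n$-periodic sequence (arguments taken modulo $n$). Kolmogorov complexity. $\mathcal{KC}(D\mid n)$ is the conditional Kolmogorov complexity of the finite object $D$ given its size $n$: the length of the shortest binary program for a fixed universal Turing machine which, with $n$ already known to the machine, produces $D$ and halts. Kolmogorov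 complexity is always understood up to an additive constant. Because $n$ is known, the scaling factor $\frac{1}{2\sqrt n}$ is available to the machine, and $\mathbf{A}_n$ may be identified with its pattern of signs. *)

theory Defs
  imports
    Complex_Main
    "HOL-Library.Z2"
    "HOL-Library.Landau_Symbols"
    "HOL-Computational_Algebra.Polynomial"
    "Jordan_Normal_Form.Matrix"
begin

text \<open>
  Deterministic multi-tape machines. Symbol 0 is the blank, symbols 1 and 2 are the binary digits 0
  and 1, and further work symbols are allowed. The start state is 0; the states below
  \<open>num_states\<close> are the active ones and the state \<open>num_states\<close> itself is the halting state.
\<close>

datatype move = Left | Stay | Right

record tm =
  num_tapes :: nat
  num_symbols :: nat
  num_states :: nat
  trans :: "nat \<Rightarrow> nat list \<Rightarrow> nat \<times> (nat \<times> move) list"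

text \<open>
  Well-formedness makes the relevant part of the transition function a finite table: it maps an
  active state and the tuple of scanned symbols to a state and one action (symbol to write, head
  move) for each tape. There are at least three tapes, for program, condition and output.
\<close>

definition wf_tm :: "tm \<Rightarrow> bool" where
  "wf_tm M \<longleftrightarrow> num_tapes M \<ge> 3 \<and> num_symbols M \<ge> 3 \<and>
     (\<forall>q < num_states M. \<forall>rs. length rs = num_tapes M \<and> (\<forall>r \<in> set rs. r < num_symbols M) \<longrightarrow>
        (case trans M q rs of (q', as) \<Rightarrow>
           q' \<le> num_states M \<and> length as = num_tapes M \<and> (\<forall>(s, d) \<in> set as. s < num_symbols M)))"

text \<open>A two-way infinite tape is given by its contents relative to the head: the scanned cell is
  cell 0, and moving the head shifts the contents.\<close>

type_synonym tape = "int \<Rightarrow> nat"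

fun offset :: "move \<Rightarrow> int" where
  "offset Left = - 1"
| "offset Stay = 0"
| "offset Right = 1"

fun act :: "tape \<Rightarrow> nat \<times> move \<Rightarrow> tape" where
  "act t (s, d) = (\<lambda>i. (t(0 := s)) (i + offset d))"

type_synonym config = "nat \<times> tape list"

fun tm_step :: "tm \<Rightarrow> config \<Rightarrow> config" where
  "tm_step M (q, ts) =
     (if q \<ge> num_states M then (q, ts)
      else case trans M q (map (\<lambda>t. t 0) ts) of (q', as) \<Rightarrow> (q', map2 act ts as))"

definition bit_symbol :: "bool \<Rightarrow> nat" where
  "bit_symbol b = (if b then 2 else 1)"

definition string_tape :: "bool list \<Rightarrow> tape" where
  "string_tape xs = (\<lambda>i. if 0 \<le> i \<and> i < int (length xs) then bit_symbol (xs ! nat i) else 0)"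

definition initial_config :: "tm \<Rightarrow> bool list \<Rightarrow> bool list \<Rightarrow> config" where
  "initial_config M p x =
     (0, [string_tape p, string_tape x] @ replicate (num_tapes M - 2) (\<lambda>_. 0))"

text \<open>The output is the string on the third tape from the head up to the first blank.\<close>

definition spells :: "tape \<Rightarrow> bool list \<Rightarrow> bool" where
  "spells t y \<longleftrightarrow> (\<forall>i < length y. t (int i) = bit_symbol (y ! i)) \<and> t (int (length y)) = 0"

definition computes :: "tm \<Rightarrow> bool list \<Rightarrow> bool list \<Rightarrow> bool list \<Rightarrow> bool" where
  "computes M p x y \<longleftrightarrow>
     (\<exists>k q ts. (tm_step M ^^ k) (initial_config M p x) = (q, ts) \<and> q = num_states M \<and> spells (ts ! 2) y)"

text \<open>A universal machine simulates every machine \<open>M\<close>, given a description \<open>w\<close> of \<open>M\<close> in front of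
  the program of \<open>M\<close>.\<close>

definition universal_tm :: "tm \<Rightarrow> bool" where
  "universal_tm U \<longleftrightarrow> wf_tm U \<and>
     (\<forall>M. wf_tm M \<longrightarrow> (\<exists>w. \<forall>p x y. computes U (w @ p) x y \<longleftrightarrow> computes M p x y))"

text \<open>Least significant digit first.\<close>

fun binary :: "nat \<Rightarrow> bool list" where
  "binary n = (if n = 0 then [] else odd n # binary (n div 2))"

declare binary.simps [simp del]

text \<open>For a universal \<open>U\<close> every string has a program, so the minimum is over a non-empty set.\<close>

definition KC :: "tm \<Rightarrow> bool list \<Rightarrow> nat \<Rightarrow> nat" where
  "KC U y n = (LEAST l. \<exists>p. length p = l \<and> computes U p (binary n) y)"

text \<open>The residue class of \<open>x\<close>, a root of \<open>f\<close>, generates the multiplicative group of the field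
  \<open>GF(2)[x]/(f)\<close>. The second conjunct says that this class is non-zero; it excludes \<open>f = x\<close>.\<close>

definition primitive_poly :: "bit poly \<Rightarrow> bool" where
  "primitive_poly f \<longleftrightarrow> irreducible f \<and> \<not> f dvd monom 1 1 \<and>
     (\<forall>g. \<not> f dvd g \<longrightarrow> (\<exists>k. f dvd g - monom 1 k))"

text \<open>Words are lists, and \<open>Poly c\<close> is the polynomial of the word \<open>c\<close>.\<close>

definition simplex_code :: "bit poly \<Rightarrow> bit list set" where
  "simplex_code f = (let n = 2 ^ degree f - 1 in
     {c. length c = n \<and> (monom 1 n - 1) div f dvd Poly c})"

definition golomb_sequences :: "bit poly \<Rightarrow> bit list set" where
  "golomb_sequences f = {c \<in> simplex_code f. \<exists>a \<in> set c. a \<noteq> 0}"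

definition periodic :: "bit list \<Rightarrow> int \<Rightarrow> bit" where
  "periodic c k = c ! nat (k mod int (length c))"

definition golomb_matrix :: "bit list \<Rightarrow> real mat" where
  "golomb_matrix c = (let n = length c in
     mat n n (\<lambda>(i, j). 1 / (2 * sqrt (real n)) *
       (- 1) ^ (of_bool (periodic c (int i - int j) = 1) + of_bool (periodic c (int j - int i) = 1))))"

definition encode_word :: "bit list \<Rightarrow> bool list" where
  "encode_word c = map (\<lambda>a. a = 1) c"

text \<open>Row by row, \<open>True\<close> for a negative entry. Given \<open>n\<close>, the entries of a Golomb matrix are
  determined by their signs.\<close>

definition sign_pattern :: "real mat \<Rightarrow> bool list" where
  "sign_pattern A = [A $$ (i, j) < 0. i \<leftarrow> [0..<dim_row A], j \<leftarrow> [0..<dim_col A]]"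

end

theory Submission
  imports
    Defs
    "HOL-Computational_Algebra.Polynomial_Factorial"
    "HOL-Real_Asymp.Real_Asymp"
begin

text \<open>
  Three effective rules, which involve neither \<open>f\<close> nor \<open>\<phi>\<close> as a parameter, lead from a string of
  \<open>2 * m + 1\<close> bits to a codeword \<open>\<phi>\<close>, from \<open>\<phi>\<close> to the sign pattern of its matrix, and from the sign
  pattern back to \<open>\<phi>\<close>. An effective rule \<open>y \<mapsto> z\<close> gives \<open>KC z \<le> KC y + O(1)\<close>, because a universal
  machine simulates the machine that first runs like the universal machine and then applies the
  rule to the output (\<open>KC_post_process\<close>).

  The string consists of the coefficients of \<open>f\<close> and the first \<open>m\<close> entries of \<open>\<phi>\<close>. Since \<open>f\<close>
  divides \<open>x ^ n - 1\<close>, the codeword satisfies the linear recurrence with coefficients \<open>f\<close>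
  (\<open>filter_seq_golomb\<close>), and \<open>m\<close> initial values determine a solution. Hence \<open>KC \<phi>\<close> is at most
  \<open>2 * m + O(1)\<close>, where \<open>m = log 2 (n + 1)\<close>. The second rule is the definition of the matrix.

  The third rule must recover \<open>\<phi>\<close> from signs that only show \<open>\<phi>(j) + \<phi>(-j)\<close>. The word \<open>\<phi>\<close> and its
  reversal \<open>\<psi>\<close> have the same signs, but for \<open>m \<ge> 3\<close> nothing else is lost
  (\<open>reversal_sum_determines\<close>): let \<open>b\<close> satisfy a non-trivial recurrence \<open>g\<close> of order at most \<open>m\<close>
  and have the same signs. Then \<open>g\<close> times its reciprocal annihilates \<open>\<phi> + \<psi>\<close>. The annihilators of
  \<open>\<phi>\<close> and \<open>\<psi>\<close> are generated by \<open>f\<close> and by its reciprocal, which are coprime, so the product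
  annihilates \<open>\<phi>\<close> as well; therefore \<open>f\<close> divides \<open>g\<close> or its reciprocal, by degrees it equals the
  one that it divides, and coprimality once more yields \<open>b = \<phi>\<close> or \<open>b = \<psi>\<close>. That \<open>f\<close> differs from
  its reciprocal is where primitivity enters again (\<open>primitive_not_dvd_reflect\<close>): \<open>1 + x\<close> is a power
  \<open>x ^ k\<close> modulo \<open>f\<close>, and if the same held with \<open>x\<close> replaced by its inverse, the two equations would
  give \<open>1 + x + x ^ 2 = 0\<close>. So an exhaustive search over pairs of a word \<open>b\<close> and a polynomial \<open>g\<close>
  ends with \<open>\<phi>\<close> or \<open>\<psi>\<close>. One machine prints the word found and another one its reversal, and one of
  the two prints \<open>\<phi>\<close>. For \<open>m \<le> 2\<close> the bound \<open>2 * m + O(1)\<close> is itself a constant.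

  The searches are bounded, so the three rules are primitive recursive functions of numerical codes
  of words. Terms for primitive recursive functions are compiled into register programs, and these
  into machines whose registers are head positions; \<open>post_process\<close> attaches such a machine to an
  arbitrary one.
\<close>

section \<open>Combining Turing machines\<close>

definition exec :: "tm \<Rightarrow> tape list \<Rightarrow> tape list \<Rightarrow> bool" where
  "exec M ts ts' \<longleftrightarrow> (\<exists>k. (tm_step M ^^ k) (0, ts) = (num_states M, ts'))"

definition wf_on :: "nat \<Rightarrow> nat \<Rightarrow> tm \<Rightarrow> bool" where
  "wf_on K G M \<longleftrightarrow> wf_tm M \<and> num_tapes M = K \<and> num_symbols M = G"

text \<open>
  All machines that are combined have the same tapes and the same symbols. Every combinator starts
  in state 0 and ends in its halting state, so that control passes on by shifting state numbers.
\<close>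

definition tape_op :: "nat \<Rightarrow> nat \<Rightarrow> nat \<Rightarrow> (nat list \<Rightarrow> nat \<times> move) \<Rightarrow> tm" where
  "tape_op K G j g = \<lparr>num_tapes = K, num_symbols = G, num_states = 1,
     trans = (\<lambda>q rs. (1, (map (\<lambda>s. (s, Stay)) rs)[j := g rs]))\<rparr>"

definition seq :: "tm \<Rightarrow> tm \<Rightarrow> tm" where
  "seq M N = \<lparr>num_tapes = num_tapes M, num_symbols = num_symbols M,
     num_states = num_states M + num_states N,
     trans = (\<lambda>q rs. if q < num_states M then trans M q rs
       else apfst ((+) (num_states M)) (trans N (q - num_states M) rs))\<rparr>"

text \<open>
  State 0 tests the scanned symbols and the body occupies the states from 1 on. If the body has no
  active state, its start state already is its halting state, which is identified with the test.
\<close>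

definition loop :: "(nat list \<Rightarrow> bool) \<Rightarrow> tm \<Rightarrow> tm" where
  "loop P M = \<lparr>num_tapes = num_tapes M, num_symbols = num_symbols M,
     num_states = Suc (num_states M),
     trans = (\<lambda>q rs. if q = 0
       then (if P rs then if num_states M = 0 then 0 else 1 else Suc (num_states M), map (\<lambda>s. (s, Stay)) rs)
       else apfst (\<lambda>q'. if q' = num_states M then 0 else Suc q') (trans M (q - 1) rs))\<rparr>"

definition widen :: "nat \<Rightarrow> tm \<Rightarrow> tm" where
  "widen K M = \<lparr>num_tapes = K, num_symbols = num_symbols M, num_states = num_states M,
     trans = (\<lambda>q rs. apsnd (\<lambda>as. as @ map (\<lambda>s. (s, Stay)) (drop (num_tapes M) rs))
       (trans M q (take (num_tapes M) rs)))\<rparr>"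

lemma act_Stay [simp]: "act t (t 0, Stay) = t"
  by (auto simp: fun_eq_iff)

lemma map2_act_Stay [simp]: "map2 act ts (map (\<lambda>s. (s, Stay)) (map (\<lambda>t. t 0) ts)) = ts"
  by (induction ts) (auto simp del: act.simps)

lemma act_less: "(\<And>i. t i < G) \<Longrightarrow> fst a < G \<Longrightarrow> act t a i < G"
  by (cases a) auto

lemma wf_tm_trans:
  assumes "wf_tm M" "q < num_states M" "length rs = num_tapes M" "\<And>r. r \<in> set rs \<Longrightarrow> r < num_symbols M"
  shows "fst (trans M q rs) \<le> num_states M" "length (snd (trans M q rs)) = num_tapes M"
    "\<And>a. a \<in> set (snd (trans M q rs)) \<Longrightarrow> fst a < num_symbols M"
  using assms unfolding wf_tm_def by (fastforce split: prod.splits)+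

lemma wf_tmI:
  assumes "num_tapes M \<ge> 3" "num_symbols M \<ge> 3"
    and "\<And>q rs. q < num_states M \<Longrightarrow> length rs = num_tapes M \<Longrightarrow> (\<And>r. r \<in> set rs \<Longrightarrow> r < num_symbols M) \<Longrightarrow>
      fst (trans M q rs) \<le> num_states M \<and> length (snd (trans M q rs)) = num_tapes M \<and>
      (\<forall>a \<in> set (snd (trans M q rs)). fst a < num_symbols M)"
  shows "wf_tm M"
  using assms unfolding wf_tm_def by (fastforce split: prod.splits)

lemma wf_tape_op:
  assumes "K \<ge> 3" "G \<ge> 3"
    and "\<And>rs. length rs = K \<Longrightarrow> (\<And>r. r \<in> set rs \<Longrightarrow> r < G) \<Longrightarrow> fst (g rs) < G"
  shows "wf_on K G (tape_op K G j g)"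
  unfolding wf_on_def
proof (intro conjI, rule wf_tmI)
  fix q rs assume *: "length rs = num_tapes (tape_op K G j g)"
    "\<And>r. r \<in> set rs \<Longrightarrow> r < num_symbols (tape_op K G j g)"
  then have "fst (g rs) < G"
    using assms(3)[of rs] by (simp add: tape_op_def)
  moreover have "fst a < G" if "a \<in> set (map (\<lambda>s. (s, Stay)) rs)" for a
    using that * by (auto simp: tape_op_def)
  moreover have "set ((map (\<lambda>s. (s, Stay)) rs)[j := g rs]) \<subseteq> insert (g rs) (set (map (\<lambda>s. (s, Stay)) rs))"
    by (rule set_update_subset_insert)
  ultimately show "fst (trans (tape_op K G j g) q rs) \<le> num_states (tape_op K G j g) \<and>
      length (snd (trans (tape_op K G j g) q rs)) = num_tapes (tape_op K G j g) \<and>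
      (\<forall>a \<in> set (snd (trans (tape_op K G j g) q rs)). fst a < num_symbols (tape_op K G j g))"
    using * by (auto simp: tape_op_def)
qed (use assms in \<open>auto simp: tape_op_def\<close>)

lemma wf_seq:
  assumes "wf_on K G M" "wf_on K G N"
  shows "wf_on K G (seq M N)"
  unfolding wf_on_def
proof (intro conjI, rule wf_tmI)
  fix q rs assume *: "q < num_states (seq M N)" "length rs = num_tapes (seq M N)"
    "\<And>r. r \<in> set rs \<Longrightarrow> r < num_symbols (seq M N)"
  show "fst (trans (seq M N) q rs) \<le> num_states (seq M N) \<and>
      length (snd (trans (seq M N) q rs)) = num_tapes (seq M N) \<and>
      (\<forall>a \<in> set (snd (trans (seq M N) q rs)). fst a < num_symbols (seq M N))"
  proof (cases "q < num_states M")
    case True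
    then show ?thesis
      using * assms wf_tm_trans[of M q rs] by (auto simp: seq_def wf_on_def)
  next
    case False
    then show ?thesis
      using * assms wf_tm_trans[of N "q - num_states M" rs] by (auto simp: seq_def wf_on_def)
  qed
qed (use assms in \<open>auto simp: seq_def wf_on_def wf_tm_def\<close>)

lemma wf_loop:
  assumes "wf_on K G M"
  shows "wf_on K G (loop P M)"
  unfolding wf_on_def
proof (intro conjI, rule wf_tmI)
  fix q rs assume *: "q < num_states (loop P M)" "length rs = num_tapes (loop P M)"
    "\<And>r. r \<in> set rs \<Longrightarrow> r < num_symbols (loop P M)"
  show "fst (trans (loop P M) q rs) \<le> num_states (loop P M) \<and>
      length (snd (trans (loop P M) q rs)) = num_tapes (loop P M) \<and>
      (\<forall>a \<in> set (snd (trans (loop P M) q rs)). fst a < num_symbols (loop P M))"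
  proof (cases "q = 0")
    case True
    then show ?thesis
      using * assms by (auto simp: loop_def wf_on_def)
  next
    case False
    then show ?thesis
      using * assms wf_tm_trans[of M "q - 1" rs] by (auto simp: loop_def wf_on_def)
  qed
qed (use assms in \<open>auto simp: loop_def wf_on_def wf_tm_def\<close>)

lemma wf_widen:
  assumes "wf_tm M" "num_tapes M \<le> K"
  shows "wf_on K (num_symbols M) (widen K M)"
  unfolding wf_on_def
proof (intro conjI, rule wf_tmI)
  fix q rs assume *: "q < num_states (widen K M)" "length rs = num_tapes (widen K M)"
    "\<And>r. r \<in> set rs \<Longrightarrow> r < num_symbols (widen K M)"
  then show "fst (trans (widen K M) q rs) \<le> num_states (widen K M) \<and>
      length (snd (trans (widen K M) q rs)) = num_tapes (widen K M) \<and>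
      (\<forall>a \<in> set (snd (trans (widen K M) q rs)). fst a < num_symbols (widen K M))"
    using assms wf_tm_trans[of M q "take (num_tapes M) rs"]
    by (fastforce simp: widen_def dest: in_set_takeD in_set_dropD)
qed (use assms in \<open>auto simp: widen_def wf_tm_def\<close>)

text \<open>
  The assumption speaks of active states only. A machine rests once it has halted, so a run that
  reaches the halting state cannot have passed through any other state that is not active.
\<close>

lemma run_embed:
  assumes "\<And>q ts. q < num_states M \<Longrightarrow> tm_step N (h q, ts) = apfst h (tm_step M (q, ts))"
    and "(tm_step M ^^ k) (q, ts) = (num_states M, ts')"
  shows "\<exists>l. (tm_step N ^^ l) (h q, ts) = (h (num_states M), ts')"
  using assms(2)
proof (induction k arbitrary: q ts)
  case 0
  then show ?case by (intro exI[of _ 0]) auto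
next
  case (Suc k)
  show ?case
  proof (cases "q < num_states M")
    case True
    obtain q1 ts1 where s: "tm_step M (q, ts) = (q1, ts1)" by force
    with Suc.prems have "(tm_step M ^^ k) (q1, ts1) = (num_states M, ts')"
      by (simp add: funpow_swap1)
    then obtain l where "(tm_step N ^^ l) (h q1, ts1) = (h (num_states M), ts')"
      using Suc.IH by blast
    then have "(tm_step N ^^ Suc l) (h q, ts) = (h (num_states M), ts')"
      using assms(1)[OF True, of ts] s by (simp add: funpow_swap1 del: tm_step.simps)
    then show ?thesis by blast
  next
    case False
    then have "tm_step M (q, ts) = (q, ts)" by simp
    then have "(tm_step M ^^ Suc k) (q, ts) = (q, ts)"
      by (induction k) (auto simp del: tm_step.simps)
    with Suc.prems show ?thesis by (intro exI[of _ 0]) auto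
  qed
qed

lemma run_trans:
  "(f ^^ k) a = b \<Longrightarrow> (f ^^ l) b = c \<Longrightarrow> \<exists>j. (f ^^ j) a = c"
  by (rule exI[of _ "l + k"]) (simp add: funpow_add)

lemma exec_tape_op:
  assumes "j < length ts"
  shows "exec (tape_op K G j g) ts (ts[j := act (ts ! j) (g (map (\<lambda>t. t 0) ts))])"
proof -
  have "map2 act ts ((map (\<lambda>s. (s, Stay)) (map (\<lambda>t. t 0) ts))[j := g (map (\<lambda>t. t 0) ts)])
      = ts[j := act (ts ! j) (g (map (\<lambda>t. t 0) ts))]"
    using assms by (intro nth_equalityI) (auto simp: nth_list_update simp del: act.simps)
  then show ?thesis
    unfolding exec_def by (intro exI[of _ 1]) (simp add: tape_op_def)
qed

lemma exec_seq:
  assumes "exec M ts ts'" "exec N ts' ts''"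
  shows "exec (seq M N) ts ts''"
proof -
  obtain k l where k: "(tm_step M ^^ k) (0, ts) = (num_states M, ts')"
    and l: "(tm_step N ^^ l) (0, ts') = (num_states N, ts'')"
    using assms by (auto simp: exec_def)
  have "\<exists>k'. (tm_step (seq M N) ^^ k') (id 0, ts) = (id (num_states M), ts')"
    by (rule run_embed[OF _ k]) (auto simp: seq_def split: prod.splits)
  then obtain k' where "(tm_step (seq M N) ^^ k') (0, ts) = (num_states M, ts')"
    by auto
  moreover have "\<exists>l'. (tm_step (seq M N) ^^ l') (num_states M + 0, ts') = (num_states M + num_states N, ts'')"
    by (rule run_embed[OF _ l]) (auto simp: seq_def split: prod.splits)
  then obtain l' where "(tm_step (seq M N) ^^ l') (num_states M, ts') = (num_states (seq M N), ts'')"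
    by (auto simp: seq_def)
  ultimately show ?thesis
    unfolding exec_def by (rule run_trans)
qed

lemma exec_loop_stop:
  assumes "\<not> P (map (\<lambda>t. t 0) ts)"
  shows "exec (loop P M) ts ts"
  unfolding exec_def using assms by (intro exI[of _ 1]) (simp add: loop_def del: map_map)

lemma exec_loop_step:
  assumes "P (map (\<lambda>t. t 0) ts)" "exec M ts ts'" "exec (loop P M) ts' ts''"
  shows "exec (loop P M) ts ts''"
proof -
  obtain k where k: "(tm_step M ^^ k) (0, ts) = (num_states M, ts')"
    using assms by (auto simp: exec_def)
  let ?h = "\<lambda>q. if q = num_states M then 0 else Suc q"
  have "\<exists>l. (tm_step (loop P M) ^^ l) (?h 0, ts) = (?h (num_states M), ts')"
    by (rule run_embed[OF _ k]) (auto simp: loop_def split: prod.splits)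
  then obtain l where l: "(tm_step (loop P M) ^^ l) (?h 0, ts) = (0, ts')"
    by auto
  have "(tm_step (loop P M) ^^ 1) (0, ts) = (?h 0, ts)"
    using assms(1) by (simp add: loop_def del: map_map)
  from run_trans[OF this l] obtain j where j: "(tm_step (loop P M) ^^ j) (0, ts) = (0, ts')"
    by blast
  from assms(3) obtain i where i: "(tm_step (loop P M) ^^ i) (0, ts') = (num_states (loop P M), ts'')"
    by (auto simp: exec_def)
  from run_trans[OF j i] show ?thesis
    by (simp add: exec_def)
qed

text \<open>
  On valid symbols a well-formed machine yields exactly one action per tape, so that the actions
  appended for the new tapes are aligned with these tapes. Hence the bound on the symbols, which the
  run preserves.
\<close>

lemma exec_widen:
  assumes wf: "wf_tm M" and K: "num_tapes M + length vs = K"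
    and "(tm_step M ^^ k) (q, us) = (q', us')" "length us = num_tapes M"
    and "\<And>t i. t \<in> set us \<Longrightarrow> t i < num_symbols M"
  shows "(tm_step (widen K M) ^^ k) (q, us @ vs) = (q', us' @ vs) \<and> length us' = num_tapes M"
  using assms(3-)
proof (induction k arbitrary: q us)
  case 0
  then show ?case by simp
next
  case (Suc k)
  show ?case
  proof (cases "q < num_states M")
    case True
    obtain q1 as where qas: "trans M q (map (\<lambda>t. t 0) us) = (q1, as)" by force
    have as: "length as = num_tapes M" "\<And>a. a \<in> set as \<Longrightarrow> fst a < num_symbols M"
      using wf_tm_trans[OF wf True, of "map (\<lambda>t. t 0) us"] Suc.prems qas by auto
    have s: "tm_step M (q, us) = (q1, map2 act us as)"
      using True qas by simp
    have m: "map2 act vs (map (\<lambda>s. (s, Stay)) (map (\<lambda>t. t 0) vs)) = vs"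
      by (rule map2_act_Stay)
    have s': "tm_step (widen K M) (q, us @ vs) = (q1, map2 act us as @ vs)"
      using True qas as Suc.prems(2) m by (simp add: widen_def del: map2_act_Stay map_map)
    have "(tm_step M ^^ k) (q1, map2 act us as) = (q', us')"
      using Suc.prems(1) s by (simp add: funpow_swap1 del: tm_step.simps)
    then have "(tm_step (widen K M) ^^ k) (q1, map2 act us as @ vs) = (q', us' @ vs) \<and> length us' = num_tapes M"
    proof (rule Suc.IH)
      show "length (map2 act us as) = num_tapes M" using as Suc.prems by simp
      fix t i assume "t \<in> set (map2 act us as)"
      then obtain u a where "u \<in> set us" "a \<in> set as" "t = act u a"
        by (auto dest: set_zip_leftD set_zip_rightD simp del: act.simps)
      then show "t i < num_symbols M"
        using Suc.prems(3) as(2) act_less by metis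
    qed
    then show ?thesis
      using s' by (simp add: funpow_swap1 del: tm_step.simps)
  next
    case False
    then have "tm_step M (q, us) = (q, us)" "tm_step (widen K M) (q, us @ vs) = (q, us @ vs)"
      by (auto simp: widen_def)
    moreover from this have "(tm_step M ^^ Suc k) (q, us) = (q, us)"
      "(tm_step (widen K M) ^^ Suc k) (q, us @ vs) = (q, us @ vs)"
      by (induction k) (auto simp del: tm_step.simps)
    ultimately show ?thesis using Suc.prems by simp
  qed
qed

section \<open>Register programs\<close>

datatype prog = Increment nat | Decrement nat | Then prog prog | While_pos nat prog

inductive runs :: "prog \<Rightarrow> (nat \<Rightarrow> nat) \<Rightarrow> (nat \<Rightarrow> nat) \<Rightarrow> bool" where
  inc: "runs (Increment r) s (s(r := Suc (s r)))"
| dec: "runs (Decrement r) s (s(r := s r - 1))"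
| thn: "runs p s s' \<Longrightarrow> runs q s' s'' \<Longrightarrow> runs (Then p q) s s''"
| stop: "s r = 0 \<Longrightarrow> runs (While_pos r p) s s"
| step: "s r > 0 \<Longrightarrow> runs p s s' \<Longrightarrow> runs (While_pos r p) s' s'' \<Longrightarrow> runs (While_pos r p) s s''"

fun num_regs :: "prog \<Rightarrow> nat" where
  "num_regs (Increment r) = Suc r"
| "num_regs (Decrement r) = Suc r"
| "num_regs (Then p q) = max (num_regs p) (num_regs q)"
| "num_regs (While_pos r p) = max (Suc r) (num_regs p)"

text \<open>
  A register is a tape with a single mark, and its value is the distance of the head from the mark.
  Then incrementing and decrementing are head moves and the test for zero reads the mark.
\<close>

definition counter_tape :: "nat \<Rightarrow> tape" where
  "counter_tape v = (\<lambda>i. if i = - int v then 1 else 0)"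

definition reg_tapes :: "nat \<Rightarrow> (nat \<Rightarrow> nat) \<Rightarrow> tape list" where
  "reg_tapes R s = map (\<lambda>r. counter_tape (s r)) [0..<R]"

fun machine :: "nat \<Rightarrow> nat \<Rightarrow> nat \<Rightarrow> prog \<Rightarrow> tm" where
  "machine K G b (Increment r) = tape_op K G (b + r) (\<lambda>rs. (rs ! (b + r), Right))"
| "machine K G b (Decrement r) =
     tape_op K G (b + r) (\<lambda>rs. (rs ! (b + r), if rs ! (b + r) = 1 then Stay else Left))"
| "machine K G b (Then p q) = seq (machine K G b p) (machine K G b q)"
| "machine K G b (While_pos r p) = loop (\<lambda>rs. rs ! (b + r) \<noteq> 1) (machine K G b p)"

lemma counter_tape_0: "counter_tape v 0 = (if v = 0 then 1 else 0)"
  by (simp add: counter_tape_def)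

lemma counter_tape_Right: "act (counter_tape v) (counter_tape v 0, Right) = counter_tape (Suc v)"
  by (auto simp: counter_tape_def fun_eq_iff)

lemma counter_tape_Left: "v > 0 \<Longrightarrow> act (counter_tape v) (counter_tape v 0, Left) = counter_tape (v - 1)"
  by (auto simp: counter_tape_def fun_eq_iff)

lemma length_reg_tapes [simp]: "length (reg_tapes R s) = R"
  by (simp add: reg_tapes_def)

lemma nth_reg_tapes [simp]: "r < R \<Longrightarrow> reg_tapes R s ! r = counter_tape (s r)"
  by (simp add: reg_tapes_def)

lemma reg_tapes_update: "r < R \<Longrightarrow> (reg_tapes R s)[r := counter_tape v] = reg_tapes R (s(r := v))"
  by (intro nth_equalityI) (auto simp: nth_list_update)

lemma wf_machine:
  "K \<ge> 3 \<Longrightarrow> G \<ge> 3 \<Longrightarrow> b + num_regs p \<le> K \<Longrightarrow> wf_on K G (machine K G b p)"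
  by (induction p) (auto intro!: wf_tape_op wf_seq wf_loop)

lemma exec_reg_op:
  assumes "length us = b" "r < R"
    and "act (counter_tape (s r)) (g (map (\<lambda>t. t 0) (us @ reg_tapes R s))) = counter_tape v"
  shows "exec (tape_op (b + R) G (b + r) g) (us @ reg_tapes R s) (us @ reg_tapes R (s(r := v)))"
  using exec_tape_op[of "b + r" "us @ reg_tapes R s" "b + R" G g] assms
  by (simp add: nth_append list_update_append reg_tapes_update)

lemma exec_tape_op_left:
  assumes "j < length us"
  shows "exec (tape_op K G j g) (us @ vs)
    (us[j := act (us ! j) (g (map (\<lambda>t. t 0) us @ map (\<lambda>t. t 0) vs))] @ vs)"
  using exec_tape_op[of j "us @ vs" K G g] assms
  by (simp add: nth_append list_update_append)

lemma exec_machine: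
  assumes "runs p s s'" "length us = b" "num_regs p \<le> R"
  shows "exec (machine (b + R) G b p) (us @ reg_tapes R s) (us @ reg_tapes R s')"
  using assms
proof induction
  case (inc r s)
  show ?case unfolding machine.simps
    using inc by (intro exec_reg_op) (auto simp: nth_append counter_tape_Right simp del: act.simps)
next
  case (dec r s)
  show ?case unfolding machine.simps
    using dec counter_tape_Left[of "s r"] act_Stay[of "counter_tape 0"]
    by (intro exec_reg_op) (auto simp: nth_append counter_tape_0 simp del: act.simps act_Stay)
next
  case (thn p s s' q s'')
  then show ?case by (auto intro: exec_seq)
next
  case (stop s r p)
  then show ?case unfolding machine.simps
    by (intro exec_loop_stop) (auto simp: nth_append counter_tape_0)
next
  case (step s r p s' s'')
  show ?case unfolding machine.simps
  proof (rule exec_loop_step)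
    show "map (\<lambda>t. t 0) (us @ reg_tapes R s) ! (b + r) \<noteq> 1"
      using step by (auto simp: nth_append counter_tape_0)
  qed (use step in auto)
qed

definition clear :: "nat \<Rightarrow> prog" where
  "clear r = While_pos r (Decrement r)"

definition add_to :: "nat \<Rightarrow> nat \<Rightarrow> prog" where
  "add_to a b = While_pos a (Then (Decrement a) (Increment b))"

definition move_to :: "nat \<Rightarrow> nat \<Rightarrow> prog" where
  "move_to a b = Then (clear b) (add_to a b)"

text \<open>
  Reading a register empties it, so two copies are made and the scratch register \<open>t\<close> is used to
  restore \<open>a\<close>.
\<close>

definition copy :: "nat \<Rightarrow> nat \<Rightarrow> nat \<Rightarrow> prog" where
  "copy a b t = Then (clear b) (Then (clear t)
     (Then (While_pos a (Then (Decrement a) (Then (Increment b) (Increment t)))) (add_to t a)))"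

lemma runs_clear: "runs (clear r) s (s(r := 0))"
proof (induction "s r" arbitrary: s)
  case 0
  then have "s(r := 0) = s" by auto
  then show ?case using stop[of s r] 0 by (simp add: clear_def)
next
  case (Suc k)
  show ?case unfolding clear_def
    by (rule step[OF _ dec]) (use Suc(1)[of "s(r := s r - 1)"] Suc(2) in \<open>auto simp: clear_def\<close>)
qed

lemma runs_add_to: "a \<noteq> b \<Longrightarrow> runs (add_to a b) s (s(b := s b + s a, a := 0))"
proof (induction "s a" arbitrary: s)
  case 0
  then have "s(b := s b + s a, a := 0) = s" by auto
  then show ?case using stop[of s a] 0 by (simp add: add_to_def)
next
  case (Suc k)
  let ?s = "s(a := s a - 1, b := Suc (s b))"
  have "?s(b := ?s b + ?s a, a := 0) = s(b := s b + s a, a := 0)"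
    using Suc by (auto simp: fun_eq_iff)
  then have "runs (While_pos a (Then (Decrement a) (Increment b))) ?s (s(b := s b + s a, a := 0))"
    using Suc(1)[of ?s] Suc(2,3) by (auto simp: add_to_def)
  moreover have body: "runs (Then (Decrement a) (Increment b)) s ?s"
    by (rule thn[OF dec]) (use inc[of b "s(a := s a - 1)"] Suc(3) in simp)
  moreover have "s a > 0" using Suc(2) by simp
  ultimately show ?case unfolding add_to_def using step[OF _ body] by blast
qed

lemma runs_move_to: "a \<noteq> b \<Longrightarrow> runs (move_to a b) s (s(b := s a, a := 0))"
  unfolding move_to_def
  by (rule thn[OF runs_clear]) (use runs_add_to[of a b "s(b := 0)"] in simp)

lemma runs_add_to_both:
  assumes "a \<noteq> b" "a \<noteq> t" "b \<noteq> t"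
  shows "runs (While_pos a (Then (Decrement a) (Then (Increment b) (Increment t)))) s
    (s(b := s b + s a, t := s t + s a, a := 0))"
    (is "runs ?p s (?r s)")
proof (induction "s a" arbitrary: s)
  case 0
  then have z: "s a = 0" by (rule sym)
  then have "?r s = s" by (simp add: fun_eq_iff)
  then show ?case using stop[of s a, OF z] by metis
next
  case (Suc k)
  let ?s1 = "s(a := s a - 1)"
  let ?s2 = "?s1(b := Suc (s b))"
  let ?s = "?s2(t := Suc (s t))"
  have "runs (Decrement a) s ?s1" by (rule dec)
  moreover have "runs (Increment b) ?s1 ?s2"
    using inc[of b ?s1] assms by simp
  moreover have "runs (Increment t) ?s2 ?s"
    using inc[of t ?s2] assms by simp
  ultimately have body: "runs (Then (Decrement a) (Then (Increment b) (Increment t))) s ?s"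
    by (intro thn)
  have "?s a = k" using Suc(2) assms by simp
  moreover have "?r ?s = ?r s"
    using Suc(2)[symmetric] assms by (simp add: fun_eq_iff)
  ultimately have "runs ?p ?s (?r s)"
    using Suc(1)[of ?s] by metis
  moreover have "s a > 0" using Suc(2) by simp
  ultimately show ?case using step[OF _ body] by blast
qed

lemma runs_copy:
  assumes "a \<noteq> b" "a \<noteq> t" "b \<noteq> t"
  shows "runs (copy a b t) s (s(b := s a, t := 0))"
proof -
  let ?p = "While_pos a (Then (Decrement a) (Then (Increment b) (Increment t)))"
  let ?s0 = "s(b := 0, t := 0)"
  let ?s1 = "s(b := s a, t := s a, a := 0)"
  have "?s0(b := ?s0 b + ?s0 a, t := ?s0 t + ?s0 a, a := 0) = ?s1"
    using assms by (simp add: fun_eq_iff)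
  then have "runs ?p ?s0 ?s1"
    using runs_add_to_both[OF assms, of ?s0] by simp
  moreover have "?s1(a := ?s1 a + ?s1 t, t := 0) = s(b := s a, t := 0)"
    using assms by (simp add: fun_eq_iff)
  then have "runs (add_to t a) ?s1 (s(b := s a, t := 0))"
    using runs_add_to[of t a ?s1] assms by metis
  ultimately have "runs (Then ?p (add_to t a)) ?s0 (s(b := s a, t := 0))"
    by (rule thn)
  then show ?thesis
    unfolding copy_def by (intro thn[OF runs_clear] thn[OF runs_clear])
qed

section \<open>Primitive recursion\<close>

text \<open>
  Terms for primitive recursive functions of an environment. Variables are de Bruijn indices: in the
  step of a recursion, variable 0 is the counter, variable 1 is the accumulator, and the variables of
  the context follow.
\<close>

datatype expr = Var nat | Zero | Succ expr | Rec expr expr expr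

fun eval :: "expr \<Rightarrow> (nat \<Rightarrow> nat) \<Rightarrow> nat" where
  "eval (Var i) e = e i"
| "eval Zero e = 0"
| "eval (Succ a) e = Suc (eval a e)"
| "eval (Rec b z s) e = rec_nat (eval z e) (\<lambda>i a. eval s (case_nat i (case_nat a e))) (eval b e)"

text \<open>
  The renaming \<open>\<rho>\<close> says in which register a variable is kept. The result goes to register \<open>d\<close>; the
  registers below \<open>d\<close> are preserved and the others are scratch space. A recursion keeps its
  accumulator in \<open>d\<close>, the number of rounds left in \<open>d + 1\<close> and its counter in \<open>d + 2\<close>.
\<close>

fun compile :: "expr \<Rightarrow> (nat \<Rightarrow> nat) \<Rightarrow> nat \<Rightarrow> prog" where
  "compile (Var i) \<rho> d = copy (\<rho> i) d (d + 1)"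
| "compile Zero \<rho> d = clear d"
| "compile (Succ a) \<rho> d = Then (compile a \<rho> d) (Increment d)"
| "compile (Rec b z s) \<rho> d = Then (compile z \<rho> d) (Then (compile b \<rho> (d + 1)) (Then (clear (d + 2))
     (While_pos (d + 1) (Then (Decrement (d + 1))
       (Then (compile s (case_nat (d + 2) (case_nat d \<rho>)) (d + 3))
       (Then (Increment (d + 2)) (move_to (d + 3) d)))))))"

lemma runs_compile:
  "(\<And>i. \<rho> i < d) \<Longrightarrow>
    \<exists>s'. runs (compile t \<rho> d) s s' \<and> s' d = eval t (\<lambda>i. s (\<rho> i)) \<and> (\<forall>r < d. s' r = s r)"
proof (induction t arbitrary: \<rho> d s)
  case (Var i)
  have "\<rho> i \<noteq> d" "\<rho> i \<noteq> d + 1" using Var[of i] by auto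
  then have "runs (compile (Var i) \<rho> d) s (s(d := s (\<rho> i), d + 1 := 0))"
    using runs_copy[of "\<rho> i" d "d + 1" s] by simp
  then show ?case by (intro exI conjI, assumption) simp_all
next
  case Zero
  have "runs (compile Zero \<rho> d) s (s(d := 0))" by (simp add: runs_clear)
  then show ?case by (intro exI conjI, assumption) simp_all
next
  case (Succ t)
  obtain s1 where s1: "runs (compile t \<rho> d) s s1" "s1 d = eval t (\<lambda>i. s (\<rho> i))" "\<forall>r < d. s1 r = s r"
    using Succ by blast
  show ?case
  proof (intro exI conjI)
    show "runs (compile (Succ t) \<rho> d) s (s1(d := Suc (s1 d)))"
      unfolding compile.simps by (rule thn[OF s1(1) inc])
  qed (use s1(2,3) in simp_all)
next
  case (Rec b z st)
  let ?z = "eval z (\<lambda>i. s (\<rho> i))"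
  let ?f = "\<lambda>i a. eval st (case_nat i (case_nat a (\<lambda>i. s (\<rho> i))))"
  let ?body = "Then (Decrement (d + 1))
       (Then (compile st (case_nat (d + 2) (case_nat d \<rho>)) (d + 3))
       (Then (Increment (d + 2)) (move_to (d + 3) d)))"
  \<comment> \<open>Invariant: after \<open>i\<close> of \<open>i + k\<close> rounds, register \<open>d\<close> holds the \<open>i\<close>-th value of the recursion.\<close>
  have loop: "\<exists>s2. runs (While_pos (d + 1) ?body) s1 s2 \<and> s2 d = rec_nat ?z ?f (i + k) \<and> (\<forall>r < d. s2 r = s r)"
    if "s1 (d + 1) = k" "s1 (d + 2) = i" "s1 d = rec_nat ?z ?f i" "\<forall>r < d. s1 r = s r" for s1 i k
    using that
  proof (induction k arbitrary: s1 i)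
    case 0
    then show ?case by (intro exI[of _ s1]) (auto intro: stop)
  next
    case (Suc k)
    let ?s1 = "s1(d + 1 := s1 (d + 1) - 1)"
    have *: "case_nat (d + 2) (case_nat d \<rho>) j < d + 3" for j
      using Rec.prems[of "j - 2"] by (auto split: nat.splits)
    obtain s2 where s2: "runs (compile st (case_nat (d + 2) (case_nat d \<rho>)) (d + 3)) ?s1 s2"
      "s2 (d + 3) = eval st (\<lambda>j. ?s1 (case_nat (d + 2) (case_nat d \<rho>) j))"
      "\<forall>r < d + 3. s2 r = ?s1 r"
      using Rec.IH(3)[of "case_nat (d + 2) (case_nat d \<rho>)" "d + 3" ?s1, OF *] by blast
    have "(\<lambda>j. ?s1 (case_nat (d + 2) (case_nat d \<rho>) j))
        = case_nat i (case_nat (s1 d) (\<lambda>i. s (\<rho> i)))"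
    proof
      fix j show "?s1 (case_nat (d + 2) (case_nat d \<rho>) j) = case_nat i (case_nat (s1 d) (\<lambda>i. s (\<rho> i))) j"
      proof (cases "j < 2")
        case True
        then show ?thesis using Suc.prems by (auto simp: less_2_cases_iff)
      next
        case False
        then obtain l where "j = Suc (Suc l)" by (metis One_nat_def less_2_cases_iff not0_implies_Suc)
        then show ?thesis using Suc.prems Rec.prems[of l] by auto
      qed
    qed
    with s2 have s2v: "s2 (d + 3) = rec_nat ?z ?f (Suc i)"
      using Suc.prems by simp
    let ?s3 = "s2(d + 2 := Suc (s2 (d + 2)))"
    let ?s4 = "?s3(d := ?s3 (d + 3), d + 3 := 0)"
    have body: "runs ?body s1 ?s4"
      by (intro thn[OF dec] thn[OF s2(1)] thn[OF inc] runs_move_to) simp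
    have "\<exists>s5. runs (While_pos (d + 1) ?body) ?s4 s5 \<and> s5 d = rec_nat ?z ?f (Suc i + k) \<and> (\<forall>r < d. s5 r = s r)"
      by (rule Suc.IH) (use Suc.prems s2(3) s2v in simp_all)
    then obtain s5 where s5: "runs (While_pos (d + 1) ?body) ?s4 s5"
      "s5 d = rec_nat ?z ?f (i + Suc k)" "\<forall>r < d. s5 r = s r" by auto
    have "s1 (d + 1) > 0" using Suc.prems(1) by simp
    from step[OF this body s5(1)] s5(2,3) show ?case by blast
  qed
  obtain s1 where s1: "runs (compile z \<rho> d) s s1" "s1 d = ?z" "\<forall>r < d. s1 r = s r"
    using Rec.IH(2)[of \<rho> d s, OF Rec.prems] by blast
  have \<rho>: "\<rho> i < d + 1" for i using Rec.prems[of i] by simp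
  obtain s2 where s2: "runs (compile b \<rho> (d + 1)) s1 s2" "s2 (d + 1) = eval b (\<lambda>i. s1 (\<rho> i))"
    "\<forall>r < d + 1. s2 r = s1 r"
    using Rec.IH(1)[of \<rho> "d + 1" s1, OF \<rho>] by blast
  have e: "(\<lambda>i. s1 (\<rho> i)) = (\<lambda>i. s (\<rho> i))" using s1 Rec.prems by auto
  let ?s3 = "s2(d + 2 := 0)"
  obtain s4 where s4: "runs (While_pos (d + 1) ?body) ?s3 s4"
    "s4 d = rec_nat ?z ?f (0 + eval b (\<lambda>i. s (\<rho> i)))" "\<forall>r < d. s4 r = s r"
    using loop[of ?s3 "eval b (\<lambda>i. s (\<rho> i))" 0] s1 s2 e by auto
  have "runs (compile (Rec b z st) \<rho> d) s s4"
    unfolding compile.simps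
    by (intro thn[OF s1(1)] thn[OF s2(1)] thn[OF runs_clear] s4(1))
  then show ?case using s4(2,3) by auto
qed

text \<open>
  The primitive recursive functions, as functions of an environment. The closure rules below follow
  the shape of a function's definition, and a bound variable becomes variable 0 of the shifted
  environment. So membership of a concrete function follows by applying introduction rules alone.
\<close>

definition prim :: "((nat \<Rightarrow> nat) \<Rightarrow> nat) \<Rightarrow> bool" where
  "prim f \<longleftrightarrow> (\<exists>t. \<forall>e. eval t e = f e)"

lemma prim_program:
  assumes "prim (\<lambda>e. F (e 0))"
  obtains p where "\<And>s. \<exists>s'. runs p s s' \<and> s' 0 = s 0 \<and> s' 1 = F (s 0)"
proof -
  obtain t where t: "\<And>e. eval t e = F (e 0)" using assms by (auto simp: prim_def)
  show ?thesis
    by (rule that[of "compile t (\<lambda>_. 0) 1"]) (use runs_compile[of "\<lambda>_. 0" 1 t] t in auto)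
qed

lemma prim_update_program:
  assumes "prim (\<lambda>e. F (e 0))"
  obtains p where "\<And>s. \<exists>s'. runs p s s' \<and> s' 0 = F (s 0)"
proof -
  obtain p where p: "\<And>s. \<exists>s'. runs p s s' \<and> s' 0 = s 0 \<and> s' 1 = F (s 0)"
    using prim_program[OF assms] by blast
  have "\<exists>s'. runs (Then p (move_to 1 0)) s s' \<and> s' 0 = F (s 0)" for s
  proof -
    obtain s' where s': "runs p s s'" "s' 1 = F (s 0)" using p by blast
    show ?thesis
    proof (intro exI conjI)
      show "runs (Then p (move_to 1 0)) s (s'(0 := s' 1, 1 := 0))"
        by (rule thn[OF s'(1) runs_move_to]) simp
    qed (use s'(2) in simp)
  qed
  then show ?thesis by (rule that)
qed

fun rename :: "(nat \<Rightarrow> nat) \<Rightarrow> expr \<Rightarrow> expr" where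
  "rename \<rho> (Var i) = Var (\<rho> i)"
| "rename \<rho> Zero = Zero"
| "rename \<rho> (Succ a) = Succ (rename \<rho> a)"
| "rename \<rho> (Rec b z s) = Rec (rename \<rho> b) (rename \<rho> z)
     (rename (case_nat 0 (case_nat 1 (\<lambda>i. \<rho> i + 2))) s)"

lemma eval_rename: "eval (rename \<rho> t) e = eval t (\<lambda>i. e (\<rho> i))"
proof (induction t arbitrary: \<rho> e)
  case (Rec b z s)
  have "(\<lambda>j. case_nat i (case_nat a e) (case_nat 0 (case_nat 1 (\<lambda>i. \<rho> i + 2)) j))
      = case_nat i (case_nat a (\<lambda>i. e (\<rho> i)))" for i a
    by (auto simp: fun_eq_iff split: nat.splits)
  then show ?case by (simp add: Rec del: One_nat_def add_2_eq_Suc')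
qed auto

lemma prim_rename: "prim f \<Longrightarrow> prim (\<lambda>e. f (\<lambda>i. e (\<rho> i)))"
  unfolding prim_def using eval_rename by metis

lemma prim_var: "prim (\<lambda>e. e i)"
  unfolding prim_def by (rule exI[of _ "Var i"]) simp

lemma prim_Suc: "prim f \<Longrightarrow> prim (\<lambda>e. Suc (f e))"
  unfolding prim_def by (metis eval.simps(3))

lemma prim_const: "prim (\<lambda>e. c)"
proof (induction c)
  case 0
  show ?case unfolding prim_def by (rule exI[of _ Zero]) simp
next
  case (Suc c)
  then show ?case by (rule prim_Suc)
qed

lemma prim_rec:
  assumes "prim b" "prim z" "prim (\<lambda>e. s (e 0) (e 1) (\<lambda>i. e (i + 2)))"
  shows "prim (\<lambda>e. rec_nat (z e) (\<lambda>i a. s i a e) (b e))"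
proof -
  obtain tb tz ts where t: "\<And>e. eval tb e = b e" "\<And>e. eval tz e = z e"
    "\<And>e. eval ts e = s (e 0) (e 1) (\<lambda>i. e (i + 2))"
    using assms by (auto simp: prim_def)
  show ?thesis
    unfolding prim_def by (rule exI[of _ "Rec tb tz ts"]) (simp add: t)
qed

text \<open>
  A recursion of one round whose initial value is \<open>f e\<close> binds that value to a variable. Composition
  is a special case.
\<close>

lemma prim_let:
  assumes "prim (\<lambda>e. G (e 0) (\<lambda>i. e (i + 1)))" "prim f"
  shows "prim (\<lambda>e. G (f e) e)"
proof -
  have "prim (\<lambda>e. G (e 1) (\<lambda>i. e (i + 2)))"
    using prim_rename[OF assms(1), of "\<lambda>i. i + 1"] by simp
  then have "prim (\<lambda>e. rec_nat (f e) (\<lambda>i a. G a e) 1)"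
    by (intro prim_rec prim_const assms)
  then show ?thesis by simp
qed

lemma prim_comp:
  assumes "prim (\<lambda>e. G (e 0))" "prim f"
  shows "prim (\<lambda>e. G (f e))"
  by (rule prim_let[where G = "\<lambda>x e. G x"]) fact+

lemma prim_comp2:
  assumes "prim (\<lambda>e. G (e 0) (e 1))" "prim f" "prim g"
  shows "prim (\<lambda>e. G (f e) (g e))"
proof (rule prim_let[where G = "\<lambda>x e. G x (g e)"])
  show "prim (\<lambda>e. G (e 0) (g (\<lambda>i. e (i + 1))))"
  proof (rule prim_let[where G = "\<lambda>y e. G (e 0) y"])
    show "prim (\<lambda>e. G (e (0 + 1)) (e 0))"
      using prim_rename[OF assms(1), of "\<lambda>i. 1 - i"] by simp
    show "prim (\<lambda>e. g (\<lambda>i. e (i + 1)))"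
      by (rule prim_rename) fact
  qed
qed fact

lemma prim_add: "prim f \<Longrightarrow> prim g \<Longrightarrow> prim (\<lambda>e. f e + g e)"
proof (rule prim_comp2[where G = "(+)"])
  have "prim (\<lambda>e. rec_nat (e 0) (\<lambda>i a. Suc a) (e 1))"
    by (intro prim_rec prim_var prim_Suc)
  moreover have "rec_nat x (\<lambda>i a. Suc a) y = x + y" for x y :: nat
    by (induction y) auto
  ultimately show "prim (\<lambda>e. e 0 + e 1)" by (simp only:)
qed

lemma prim_mult: "prim f \<Longrightarrow> prim g \<Longrightarrow> prim (\<lambda>e. f e * g e)"
proof (rule prim_comp2[where G = "(*)"])
  have "prim (\<lambda>e. rec_nat 0 (\<lambda>i a. a + e 0) (e 1))"
    by (intro prim_rec prim_var prim_add prim_const)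
  moreover have "rec_nat 0 (\<lambda>i a. a + x) y = x * y" for x y :: nat
    by (induction y) auto
  ultimately show "prim (\<lambda>e. e 0 * e 1)" by (simp only:)
qed

text \<open>The predecessor of \<open>x\<close> is the last value of the counter in a recursion of \<open>x\<close> rounds.\<close>

lemma prim_diff: "prim f \<Longrightarrow> prim g \<Longrightarrow> prim (\<lambda>e. f e - g e)"
proof (rule prim_comp2[where G = "(-)"])
  have "prim (\<lambda>e. rec_nat 0 (\<lambda>i a. i) (e 0))"
    by (intro prim_rec prim_var prim_const)
  moreover have "rec_nat 0 (\<lambda>i a. i) x = x - 1" for x :: nat
    by (cases x) auto
  ultimately have "prim (\<lambda>e. e 0 - 1)" by (simp only:)
  then have pred: "prim f \<Longrightarrow> prim (\<lambda>e. f e - 1)" for f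
    by (rule prim_comp)
  have "prim (\<lambda>e. rec_nat (e 0) (\<lambda>i a. a - 1) (e 1))"
    by (intro prim_rec prim_var pred)
  moreover have "rec_nat x (\<lambda>i a. a - 1) y = x - y" for x y :: nat
    by (induction y) auto
  ultimately show "prim (\<lambda>e. e 0 - e 1)" by (simp only:)
qed

lemma prim_power: "prim f \<Longrightarrow> prim g \<Longrightarrow> prim (\<lambda>e. f e ^ g e)"
proof (rule prim_comp2[where G = "(^)"])
  have "prim (\<lambda>e. rec_nat 1 (\<lambda>i a. a * e 0) (e 1))"
    by (intro prim_rec prim_var prim_mult prim_const)
  moreover have "rec_nat 1 (\<lambda>i a. a * x) y = x ^ y" for x y :: nat
    by (induction y) auto
  ultimately show "prim (\<lambda>e. e 0 ^ e 1)" by (simp only:)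
qed

lemma prim_sum:
  assumes "prim b" "prim (\<lambda>e. h (e 0) (\<lambda>i. e (i + 1)))"
  shows "prim (\<lambda>e. \<Sum>i<b e. h i e)"
proof -
  have "prim (\<lambda>e. h (e 0) (\<lambda>i. e (i + 2)))"
    using prim_rename[OF assms(2), of "case_nat 0 (\<lambda>i. i + 2)"] by simp
  then have "prim (\<lambda>e. rec_nat 0 (\<lambda>i a. a + h i e) (b e))"
    by (intro prim_rec prim_const prim_add prim_var assms)
  moreover have "rec_nat 0 (\<lambda>i a. a + h i e) n = (\<Sum>i<n. h i e)" for e n
    by (induction n) auto
  ultimately show ?thesis by (simp only:)
qed

lemma prim_not: "prim (\<lambda>e. of_bool (P e)) \<Longrightarrow> prim (\<lambda>e. of_bool (\<not> P e))"
proof -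
  assume "prim (\<lambda>e. of_bool (P e))"
  then have "prim (\<lambda>e. 1 - of_bool (P e))"
    by (intro prim_diff prim_const)
  moreover have "1 - of_bool b = (of_bool (\<not> b) :: nat)" for b by simp
  ultimately show ?thesis by (simp only:)
qed

lemma prim_conj:
  "prim (\<lambda>e. of_bool (P e)) \<Longrightarrow> prim (\<lambda>e. of_bool (Q e)) \<Longrightarrow> prim (\<lambda>e. of_bool (P e \<and> Q e))"
  unfolding of_bool_conj by (rule prim_mult)

lemma prim_less: "prim f \<Longrightarrow> prim g \<Longrightarrow> prim (\<lambda>e. of_bool (f e < g e))"
proof -
  assume "prim f" "prim g"
  then have "prim (\<lambda>e. 1 - (1 - (g e - f e)))"
    by (intro prim_diff prim_const)
  moreover have "1 - (1 - (y - x)) = (of_bool (x < y) :: nat)" for x y :: nat by auto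
  ultimately show ?thesis by (simp only:)
qed

lemma prim_le: "prim f \<Longrightarrow> prim g \<Longrightarrow> prim (\<lambda>e. of_bool (f e \<le> g e))"
  using prim_not[OF prim_less[of g f]] by (simp add: not_less)

lemma prim_eq: "prim f \<Longrightarrow> prim g \<Longrightarrow> prim (\<lambda>e. of_bool (f e = g e))"
  unfolding order_eq_iff by (intro prim_conj prim_le)

lemma prim_iff:
  "prim (\<lambda>e. of_bool (P e)) \<Longrightarrow> prim (\<lambda>e. of_bool (Q e)) \<Longrightarrow> prim (\<lambda>e. of_bool (P e \<longleftrightarrow> Q e))"
  using prim_eq[of "\<lambda>e. of_bool (P e)" "\<lambda>e. of_bool (Q e)"] by (simp only: of_bool_eq_iff)

lemma prim_ex:
  assumes "prim b" "prim (\<lambda>e. of_bool (P (e 0) (\<lambda>i. e (i + 1))))"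
  shows "prim (\<lambda>e. of_bool (\<exists>i<b e. P i e))"
proof -
  have "prim (\<lambda>e. of_bool (0 < (\<Sum>i<b e. of_bool (P i e) :: nat)))"
    by (intro prim_less prim_const prim_sum assms)
  moreover have "0 < (\<Sum>i<n. of_bool (P i e) :: nat) \<longleftrightarrow> (\<exists>i<n. P i e)" for n e
    by (auto simp: sum_eq_0_iff simp flip: neq0_conv)
  ultimately show ?thesis by (simp only:)
qed

lemma prim_all:
  assumes "prim b" "prim (\<lambda>e. of_bool (P (e 0) (\<lambda>i. e (i + 1))))"
  shows "prim (\<lambda>e. of_bool (\<forall>i<b e. P i e))"
  using prim_not[OF prim_ex[OF assms(1) prim_not[OF assms(2)]]] by simp

lemma prim_div: "prim f \<Longrightarrow> prim g \<Longrightarrow> prim (\<lambda>e. f e div g e)"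
proof (rule prim_comp2[where G = "(div)"])
  have "prim (\<lambda>e. \<Sum>q<e 0. of_bool (0 < e 1 \<and> Suc q * e 1 \<le> e 0))"
    by (intro prim_sum prim_conj prim_less prim_le prim_mult prim_Suc prim_var prim_const)
  moreover have "(\<Sum>q<x. of_bool (0 < y \<and> Suc q * y \<le> x)) = x div y" for x y :: nat
  proof (cases "y = 0")
    case False
    have "(\<Sum>q<x. of_bool (0 < y \<and> Suc q * y \<le> x)) = card {q \<in> {..<x}. 0 < y \<and> Suc q * y \<le> x}"
      by (simp add: sum.If_cases of_bool_def Int_def)
    also have "{q \<in> {..<x}. 0 < y \<and> Suc q * y \<le> x} = {..<x div y}"
    proof -
      have "Suc q * y \<le> x \<longleftrightarrow> q < x div y" for q
        using False by (metis Suc_le_eq less_eq_div_iff_mult_less_eq neq0_conv)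
      moreover have "q < x" if "q < x div y" for q
        using that div_le_dividend[of x y] by linarith
      ultimately show ?thesis using False by auto
    qed
    finally show ?thesis by simp
  qed simp
  ultimately show "prim (\<lambda>e. e 0 div e 1)" by (simp only:)
qed

lemma prim_mod: "prim f \<Longrightarrow> prim g \<Longrightarrow> prim (\<lambda>e. f e mod g e)"
  unfolding modulo_nat_def by (intro prim_diff prim_mult prim_div)

lemma prim_even: "prim f \<Longrightarrow> prim (\<lambda>e. of_bool (even (f e)))"
  unfolding even_iff_mod_2_eq_zero by (intro prim_eq prim_mod prim_const)

text \<open>
  Bounded search. The least solution is the number of those \<open>k\<close> up to which no solution has
  occurred, and a sum is primitive recursive by construction.
\<close>

definition least_below :: "nat \<Rightarrow> (nat \<Rightarrow> bool) \<Rightarrow> nat" where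
  "least_below b P = (\<Sum>k<b. of_bool (\<forall>i<Suc k. \<not> P i))"

lemma least_below_eq:
  assumes "P k" "k < b" "\<And>i. i < k \<Longrightarrow> \<not> P i"
  shows "least_below b P = k"
proof -
  have "least_below b P = card {j \<in> {..<b}. \<forall>i<Suc j. \<not> P i}"
    by (simp add: least_below_def sum.If_cases of_bool_def Int_def)
  also have "{j \<in> {..<b}. \<forall>i<Suc j. \<not> P i} = {..<k}"
    using assms by (auto simp: less_Suc_eq_le) (meson leI)
  finally show ?thesis by simp
qed

lemma least_below:
  assumes "P k" "k < b"
  shows "P (least_below b P)" "least_below b P < b"
proof -
  have "least_below b P = (LEAST k. P k)"
    using assms by (intro least_below_eq) (auto intro: LeastI dest: not_less_Least le_less_trans[OF Least_le])
  moreover have "P (LEAST k. P k)" "(LEAST k. P k) \<le> k"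
    using assms by (auto intro: LeastI Least_le)
  ultimately show "P (least_below b P)" "least_below b P < b"
    using assms by auto
qed

lemma prim_least_below:
  assumes "prim b" "prim (\<lambda>e. of_bool (P (e 0) (\<lambda>i. e (i + 1))))"
  shows "prim (\<lambda>e. least_below (b e) (\<lambda>i. P i e))"
  unfolding least_below_def
proof (intro prim_sum assms prim_all prim_Suc prim_var prim_not)
  show "prim (\<lambda>e. of_bool (P (e 0) (\<lambda>i. e (i + 1 + 1))))"
    using prim_rename[OF assms(2), of "case_nat 0 (\<lambda>i. i + 2)"] by simp
qed

section \<open>Numerical codes of words\<close>

text \<open>
  Bijective base-2 numeration: the digits are the tape symbols 1 and 2 of the bits, the most
  significant one first. Every number codes exactly one word, also if the word begins with zeros, and the
  test whether a word has been consumed is a test for zero.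
\<close>

definition code :: "bool list \<Rightarrow> nat" where
  "code y = foldl (\<lambda>N b. 2 * N + bit_symbol b) 0 y"

lemma code_Nil [simp]: "code [] = 0"
  by (simp add: code_def)

lemma code_snoc [simp]: "code (y @ [b]) = 2 * code y + bit_symbol b"
  by (simp add: code_def)

lemma code_surj: "\<exists>y. code y = N"
proof (induction N rule: less_induct)
  case (less N)
  show ?case
  proof (cases "N = 0")
    case True
    then show ?thesis by (intro exI[of _ "[]"]) simp
  next
    case False
    then obtain y where "code y = (N - 1) div 2"
      using less[of "(N - 1) div 2"] by fastforce
    then have "code (y @ [even N]) = N"
      using False by (auto simp: bit_symbol_def elim!: evenE oddE)
    then show ?thesis by blast
  qed
qed

text \<open>
  In ordinary binary notation, the successor of the code of \<open>y\<close> is the digit 1 followed by \<open>y\<close>.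
  This gives the length and the digits.
\<close>

definition code_length :: "nat \<Rightarrow> nat" where
  "code_length N = least_below (N + 1) (\<lambda>k. N + 1 < 2 ^ (k + 1))"

definition code_digit :: "nat \<Rightarrow> nat \<Rightarrow> bool" where
  "code_digit N i \<longleftrightarrow> odd ((N + 1) div 2 ^ (code_length N - 1 - i))"

lemma code_bounds: "2 ^ length y \<le> code y + 1" "code y + 1 < 2 ^ (length y + 1)"
  by (induction y rule: rev_induct) (auto simp: bit_symbol_def)

lemma code_length [simp]: "code_length (code y) = length y"
proof -
  have "length y < code y + 1"
    using less_le_trans[OF less_exp code_bounds(1)] .
  moreover have "\<not> code y + 1 < 2 ^ (i + 1)" if "i < length y" for i
    using code_bounds(1)[of y] power_increasing[of "i + 1" "length y" "2 :: nat"] that by simp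
  ultimately show ?thesis
    unfolding code_length_def using code_bounds[of y] by (intro least_below_eq) auto
qed

lemma code_digit [simp]: "i < length y \<Longrightarrow> code_digit (code y) i = y ! i"
proof -
  have "i < length y \<Longrightarrow> odd ((code y + 1) div 2 ^ (length y - 1 - i)) = y ! i"
  proof (induction y rule: rev_induct)
    case (snoc b y)
    have e: "code (y @ [b]) + 1 = 2 * (code y + 1) + of_bool b"
      by (simp add: bit_symbol_def)
    show ?case
    proof (cases "i = length y")
      case True
      then show ?thesis unfolding e by simp
    next
      case False
      with snoc.prems have i: "i < length y" by simp
      then have "2 ^ (length (y @ [b]) - 1 - i) = (2 :: nat) * 2 ^ (length y - 1 - i)"
        by (simp flip: power_Suc add: Suc_diff_Suc)
      then have "(code (y @ [b]) + 1) div 2 ^ (length (y @ [b]) - 1 - i)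
          = (code y + 1) div 2 ^ (length y - 1 - i)"
        unfolding e by (simp add: div_mult2_eq)
      then show ?thesis using snoc.IH[OF i] i by (simp add: nth_append)
    qed
  qed simp
  then show "i < length y \<Longrightarrow> code_digit (code y) i = y ! i"
    by (simp add: code_digit_def)
qed

lemma prim_code_length: "prim f \<Longrightarrow> prim (\<lambda>e. code_length (f e))"
  unfolding code_length_def
  by (rule prim_comp)
    (intro prim_least_below prim_less prim_power prim_add prim_var prim_const)

lemma prim_code_digit: "prim f \<Longrightarrow> prim g \<Longrightarrow> prim (\<lambda>e. of_bool (code_digit (f e) (g e)))"
  unfolding code_digit_def
  by (intro prim_not prim_even prim_div prim_power prim_diff prim_add prim_const prim_code_length)

lemma prim_code_map:
  assumes "prim n" "prim (\<lambda>e. of_bool (g (e 0) (\<lambda>i. e (i + 1))))"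
  shows "prim (\<lambda>e. code (map (\<lambda>i. g i e) [0..<n e]))"
proof -
  have "prim (\<lambda>e. of_bool (g (e 0) (\<lambda>i. e (i + 2))))"
    using prim_rename[OF assms(2), of "case_nat 0 (\<lambda>i. i + 2)"] by simp
  then have "prim (\<lambda>e. rec_nat 0 (\<lambda>i a. 2 * a + Suc (of_bool (g i e))) (n e))"
    by (intro prim_rec prim_const prim_add prim_mult prim_Suc prim_var assms)
  moreover have "rec_nat 0 (\<lambda>i a. 2 * a + Suc (of_bool (g i e))) m = code (map (\<lambda>i. g i e) [0..<m])" for m e
    by (induction m) (auto simp: bit_symbol_def)
  ultimately show ?thesis by (simp only:)
qed

lemmas prim_intros = prim_least_below prim_sum prim_code_map prim_code_length prim_code_digit prim_all
  prim_ex prim_conj prim_not prim_iff prim_eq prim_less prim_le prim_even prim_mod prim_div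
  prim_power prim_diff prim_mult prim_add prim_Suc prim_var prim_const

section \<open>Post-processing the output of a machine\<close>

definition read_loop :: "nat \<Rightarrow> nat \<Rightarrow> nat \<Rightarrow> prog \<Rightarrow> nat \<Rightarrow> tm" where
  "read_loop K G b double t = loop (\<lambda>rs. rs ! t \<noteq> 0)
     (seq (machine K G b (Then double (Increment 0)))
     (seq (tape_op K G b (\<lambda>rs. (rs ! b, if rs ! t = 2 then Right else Stay)))
     (tape_op K G t (\<lambda>rs. (rs ! t, Right)))))"

text \<open>
  The last letter of a word is read off its code first. So the word is written from right to left,
  and at the end the head scans the first letter, as the output convention demands.
\<close>

definition write_loop :: "nat \<Rightarrow> nat \<Rightarrow> nat \<Rightarrow> prog \<Rightarrow> prog \<Rightarrow> tm" where
  "write_loop K G b parity halve = loop (\<lambda>rs. rs ! b \<noteq> 1)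
     (seq (machine K G b parity)
     (seq (tape_op K G 2 (\<lambda>rs. (rs ! 2, Left)))
     (seq (tape_op K G 2 (\<lambda>rs. (if rs ! (b + 1) = 1 then 1 else 2, Stay)))
     (machine K G b halve))))"

fun init_regs :: "nat \<Rightarrow> nat \<Rightarrow> nat \<Rightarrow> nat \<Rightarrow> tm" where
  "init_regs K G b 0 = tape_op K G 0 (\<lambda>rs. (rs ! 0, Stay))"
| "init_regs K G b (Suc r) = seq (init_regs K G b r) (tape_op K G (b + r) (\<lambda>_. (1, Stay)))"

lemma spells_Cons:
  assumes "spells T (c # y)"
  shows "T 0 = bit_symbol c" "spells (act T (T 0, Right)) y"
proof -
  have *: "T (int i) = bit_symbol ((c # y) ! i)" if "i \<le> length y" for i
    using assms that by (auto simp: spells_def)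
  show "T 0 = bit_symbol c" using *[of 0] by simp
  have "T (int i + 1) = bit_symbol (y ! i)" if "i < length y" for i
    using *[of "Suc i"] that by (simp add: add.commute)
  moreover have "T (int (length y) + 1) = 0"
    using assms by (auto simp: spells_def add.commute)
  ultimately show "spells (act T (T 0, Right)) y"
    by (auto simp: spells_def)
qed

lemma spells_push:
  assumes "spells T y"
  shows "spells (act (act T (T 0, Left)) (bit_symbol c, Stay)) (c # y)"
  using assms by (auto simp: spells_def nth_Cons less_Suc_eq_0_disj split: nat.splits)

lemma exec_read_loop:
  assumes double: "\<And>s. \<exists>s'. runs double s s' \<and> s' 0 = s 0 + s 0"
    and R: "num_regs double \<le> R" "R \<ge> 1" and t: "t < b"
  shows "length us = b \<Longrightarrow> spells (us ! t) y \<Longrightarrow>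
    \<exists>us' s'. exec (read_loop (b + R) G b double t) (us @ reg_tapes R s) (us' @ reg_tapes R s') \<and>
      length us' = b \<and> s' 0 = foldl (\<lambda>N b. 2 * N + bit_symbol b) (s 0) y"
proof (induction y arbitrary: us s)
  case Nil
  then have "(us ! t) 0 = 0" using t by (auto simp: spells_def)
  then have "exec (read_loop (b + R) G b double t) (us @ reg_tapes R s) (us @ reg_tapes R s)"
    unfolding read_loop_def using Nil t by (intro exec_loop_stop) (simp add: nth_append)
  with Nil show ?case by auto
next
  case (Cons c y)
  let ?T = "us ! t"
  note T = spells_Cons[OF Cons.prems(2)]
  obtain s1 where s1: "runs double s s1" "s1 0 = s 0 + s 0" using double by blast
  let ?s2 = "s1(0 := Suc (s1 0))"
  let ?s3 = "?s2(0 := ?s2 0 + of_bool c)"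
  let ?us = "us[t := act ?T (?T 0, Right)]"
  have e1: "exec (machine (b + R) G b (Then double (Increment 0))) (us @ reg_tapes R s) (us @ reg_tapes R ?s2)"
    using R Cons.prems by (intro exec_machine thn[OF s1(1) inc]) auto
  have e2: "exec (tape_op (b + R) G b (\<lambda>rs. (rs ! b, if rs ! t = 2 then Right else Stay)))
      (us @ reg_tapes R ?s2) (us @ reg_tapes R ?s3)"
    using exec_reg_op[of us b 0 R ?s2 "\<lambda>rs. (rs ! b, if rs ! t = 2 then Right else Stay)" "?s2 0 + of_bool c" G]
      Cons.prems(1) R(2) t T(1)
    by (cases c) (simp_all add: nth_append bit_symbol_def counter_tape_Right del: act.simps)
  have e3: "exec (tape_op (b + R) G t (\<lambda>rs. (rs ! t, Right))) (us @ reg_tapes R ?s3) (?us @ reg_tapes R ?s3)"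
    using exec_tape_op_left[of t us "b + R" G "\<lambda>rs. (rs ! t, Right)" "reg_tapes R ?s3"] Cons.prems(1) t
    by (simp add: nth_append del: act.simps)
  have "\<exists>us' s'. exec (read_loop (b + R) G b double t) (?us @ reg_tapes R ?s3) (us' @ reg_tapes R s') \<and>
      length us' = b \<and> s' 0 = foldl (\<lambda>N b. 2 * N + bit_symbol b) (?s3 0) y"
    using Cons.prems(1) T(2) t by (intro Cons.IH) (simp_all del: act.simps)
  then obtain us' s' where *: "exec (read_loop (b + R) G b double t) (?us @ reg_tapes R ?s3) (us' @ reg_tapes R s')"
    "length us' = b" "s' 0 = foldl (\<lambda>N b. 2 * N + bit_symbol b) (?s3 0) y"
    by blast
  have "?T 0 \<noteq> 0" using T(1) by (simp add: bit_symbol_def)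
  then have "map (\<lambda>t. t 0) (us @ reg_tapes R s) ! t \<noteq> 0"
    using Cons.prems(1) t by (simp add: nth_append)
  from exec_loop_step[where P = "\<lambda>rs. rs ! t \<noteq> 0", OF this exec_seq[OF e1 exec_seq[OF e2 e3]] *(1)[unfolded read_loop_def]]
  have "exec (read_loop (b + R) G b double t) (us @ reg_tapes R s) (us' @ reg_tapes R s')"
    unfolding read_loop_def .
  moreover have "s' 0 = foldl (\<lambda>N b. 2 * N + bit_symbol b) (s 0) (c # y)"
    using *(3) s1(2) by (cases c) (simp_all add: bit_symbol_def mult_2)
  ultimately show ?case using *(2) by blast
qed

lemma exec_write_loop:
  assumes parity: "\<And>s. \<exists>s'. runs parity s s' \<and> s' 0 = s 0 \<and> s' 1 = (s 0 + 1) mod 2"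
    and halve: "\<And>s. \<exists>s'. runs halve s s' \<and> s' 0 = (s 0 - 1) div 2"
    and R: "num_regs parity \<le> R" "num_regs halve \<le> R" "R \<ge> 2" and b: "2 < b"
  shows "length us = b \<Longrightarrow> spells (us ! 2) z \<Longrightarrow> s 0 = code y \<Longrightarrow>
    \<exists>us' s'. exec (write_loop (b + R) G b parity halve) (us @ reg_tapes R s) (us' @ reg_tapes R s') \<and>
      length us' = b \<and> spells (us' ! 2) (y @ z)"
proof (induction y arbitrary: us s z rule: rev_induct)
  case Nil
  then have "exec (write_loop (b + R) G b parity halve) (us @ reg_tapes R s) (us @ reg_tapes R s)"
    unfolding write_loop_def using R
    by (intro exec_loop_stop) (simp add: nth_append counter_tape_0)
  with Nil show ?case by auto
next
  case (snoc c y)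
  let ?T = "us ! 2"
  let ?T' = "act ?T (?T 0, Left)"
  obtain s1 where s1: "runs parity s s1" "s1 0 = s 0" "s1 1 = (s 0 + 1) mod 2" using parity by blast
  obtain s2 where s2: "runs halve s1 s2" "s2 0 = (s1 0 - 1) div 2" using halve by blast
  have c: "s1 1 = of_bool c" using s1 snoc.prems(3) by (cases c) (simp_all add: bit_symbol_def mod_Suc)
  have y: "s2 0 = code y" using s1 s2 snoc.prems(3) by (cases c) (simp_all add: bit_symbol_def)
  let ?us1 = "us[2 := ?T']"
  let ?us2 = "us[2 := act ?T' (bit_symbol c, Stay)]"
  have e1: "exec (machine (b + R) G b parity) (us @ reg_tapes R s) (us @ reg_tapes R s1)"
    using R snoc.prems by (intro exec_machine s1(1)) auto
  have e2: "exec (tape_op (b + R) G 2 (\<lambda>rs. (rs ! 2, Left))) (us @ reg_tapes R s1) (?us1 @ reg_tapes R s1)"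
    using exec_tape_op_left[of 2 us "b + R" G "\<lambda>rs. (rs ! 2, Left)" "reg_tapes R s1"] snoc.prems(1) b
    by (simp add: nth_append del: act.simps)
  have e3: "exec (tape_op (b + R) G 2 (\<lambda>rs. (if rs ! (b + 1) = 1 then 1 else 2, Stay)))
      (?us1 @ reg_tapes R s1) (?us2 @ reg_tapes R s1)"
    using exec_tape_op_left[of 2 ?us1 "b + R" G "\<lambda>rs. (if rs ! (b + 1) = 1 then 1 else 2, Stay)" "reg_tapes R s1"]
      snoc.prems(1) b c R(3)
    by (cases c) (simp_all add: nth_append counter_tape_0 bit_symbol_def del: act.simps)
  have e4: "exec (machine (b + R) G b halve) (?us2 @ reg_tapes R s1) (?us2 @ reg_tapes R s2)"
    using R snoc.prems by (intro exec_machine s2(1)) auto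
  have "\<exists>us' s'. exec (write_loop (b + R) G b parity halve) (?us2 @ reg_tapes R s2) (us' @ reg_tapes R s') \<and>
      length us' = b \<and> spells (us' ! 2) (y @ c # z)"
    using snoc.prems b y spells_push[OF snoc.prems(2), of c]
    by (intro snoc.IH) (simp_all del: act.simps)
  then obtain us' s' where *: "exec (write_loop (b + R) G b parity halve) (?us2 @ reg_tapes R s2) (us' @ reg_tapes R s')"
    "length us' = b" "spells (us' ! 2) (y @ c # z)" by blast
  have "s 0 \<noteq> 0" using snoc.prems(3) by (simp add: bit_symbol_def)
  then have "map (\<lambda>t. t 0) (us @ reg_tapes R s) ! b \<noteq> 1"
    using snoc.prems(1) R by (simp add: nth_append counter_tape_0)
  from exec_loop_step[where P = "\<lambda>rs. rs ! b \<noteq> 1", OF this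
      exec_seq[OF e1 exec_seq[OF e2 exec_seq[OF e3 e4]]] *(1)[unfolded write_loop_def]]
  have "exec (write_loop (b + R) G b parity halve) (us @ reg_tapes R s) (us' @ reg_tapes R s')"
    unfolding write_loop_def .
  then show ?case using *(2,3) by auto
qed

lemma exec_init_regs:
  assumes "length us = b" "b > 0"
  shows "r \<le> R \<Longrightarrow> exec (init_regs K G b r) (us @ replicate R (\<lambda>_. 0))
    (us @ replicate r (counter_tape 0) @ replicate (R - r) (\<lambda>_. 0))"
proof (induction r)
  case 0
  have "us \<noteq> []" using assms by auto
  then show ?case
    using exec_tape_op[of 0 "us @ replicate R (\<lambda>_. 0)" K G "\<lambda>rs. (rs ! 0, Stay)"] assms
    by (simp add: nth_append list_update_append1 del: act.simps)
next
  case (Suc r)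
  let ?ts = "us @ replicate r (counter_tape 0) @ replicate (R - r) (\<lambda>_. 0 :: nat)"
  have c: "act (\<lambda>_. 0) (1, Stay) = counter_tape 0"
    by (auto simp: counter_tape_def fun_eq_iff)
  have "exec (tape_op K G (b + r) (\<lambda>_. (1, Stay))) ?ts (?ts[b + r := act (?ts ! (b + r)) (1, Stay)])"
    using Suc.prems assms by (intro exec_tape_op) simp
  moreover have "?ts ! (b + r) = (\<lambda>_. 0)"
    using Suc.prems assms by (simp add: nth_append)
  moreover have "?ts[b + r := counter_tape 0]
      = us @ replicate (Suc r) (counter_tape 0) @ replicate (R - Suc r) (\<lambda>_. 0)"
  proof -
    obtain k where "R - r = Suc k" "R - Suc r = k" using Suc.prems by (metis Suc_diff_le diff_Suc_Suc)
    then show ?thesis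
      using assms by (simp add: list_update_append replicate_app_Cons_same)
  qed
  ultimately have "exec (tape_op K G (b + r) (\<lambda>_. (1, Stay))) ?ts
      (us @ replicate (Suc r) (counter_tape 0) @ replicate (R - Suc r) (\<lambda>_. 0))"
    by (simp only: c)
  then show ?case
    using exec_seq[OF Suc.IH] Suc.prems by simp
qed

text \<open>
  The machine runs \<open>U\<close>, reads the code of the word on tape \<open>t\<close> into a register, applies \<open>F\<close> and
  writes the result on tape 2. That tape may carry anything that \<open>U\<close> has left there: a blank is put
  under the head and the result is written to its left, so the old contents stay outside of the new
  output. Tape 2 is where \<open>U\<close> has its output; \<open>t = 0\<close> serves for applying \<open>F\<close> to the program itself.
\<close>

theorem post_process:
  assumes U: "wf_tm U" and t: "t < num_tapes U" and F: "prim (\<lambda>e. F (e 0))"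
  obtains M where "wf_tm M"
    and "\<And>p x y z k ts. (tm_step U ^^ k) (initial_config U p x) = (num_states U, ts) \<Longrightarrow>
      spells (ts ! t) y \<Longrightarrow> F (code y) = code z \<Longrightarrow> computes M p x z"
proof -
  define b G where "b = num_tapes U" and "G = num_symbols U"
  have b: "b \<ge> 3" and G: "G \<ge> 3" using U by (auto simp: wf_tm_def b_def G_def)
  obtain double where double: "\<And>s. \<exists>s'. runs double s s' \<and> s' 0 = s 0 + s 0"
    using prim_update_program[of "\<lambda>N. N + N"] prim_add prim_var by metis
  obtain parity where parity: "\<And>s. \<exists>s'. runs parity s s' \<and> s' 0 = s 0 \<and> s' 1 = (s 0 + 1) mod 2"
    by (rule prim_program[of "\<lambda>N. (N + 1) mod 2"]) (intro prim_intros, blast)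
  obtain halve where halve: "\<And>s. \<exists>s'. runs halve s s' \<and> s' 0 = (s 0 - 1) div 2"
    by (rule prim_update_program[of "\<lambda>N. (N - 1) div 2"]) (intro prim_intros, blast)
  obtain main where main: "\<And>s. \<exists>s'. runs main s s' \<and> s' 0 = F (s 0)"
    using prim_update_program[OF F] by blast
  define R where "R = Max {num_regs double, num_regs parity, num_regs halve, num_regs main, 2}"
  have R: "num_regs double \<le> R" "num_regs parity \<le> R" "num_regs halve \<le> R" "num_regs main \<le> R" "2 \<le> R"
    by (auto simp: R_def)
  define K where "K = b + R"
  define M where "M = seq (widen K U) (seq (init_regs K G b R) (seq (read_loop K G b double t)
    (seq (machine K G b main) (seq (tape_op K G 2 (\<lambda>_. (0, Stay))) (write_loop K G b parity halve)))))"
  have K: "K \<ge> 3" using b by (simp add: K_def)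
  have scan: "rs ! j < g" if "j < length rs" "\<forall>r. r \<in> set rs \<longrightarrow> r < g" for rs j and g :: nat
    using that nth_mem by blast
  have wf_init: "wf_on K G (init_regs K G b r)" for r
    using K G by (induction r) (auto intro!: wf_tape_op wf_seq scan)
  have "wf_on K G M"
    unfolding M_def read_loop_def write_loop_def
    using U t K G b R wf_widen[of U K]
    by (intro wf_seq wf_init wf_loop wf_machine wf_tape_op)
      (auto simp: b_def G_def K_def intro!: scan)
  then have "wf_tm M" "num_tapes M = K" by (auto simp: wf_on_def)
  moreover have "computes M p x z"
    if run: "(tm_step U ^^ k) (initial_config U p x) = (num_states U, ts)" and y: "spells (ts ! t) y"
      and z: "F (code y) = code z" for p x y z k ts
  proof -
    let ?us = "[string_tape p, string_tape x] @ replicate (b - 2) (\<lambda>_. 0 :: nat)"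
    let ?blank = "replicate R (\<lambda>_. 0 :: nat) :: tape list"
    have sym: "u i < num_symbols U" if "u \<in> set ?us" for u i
      using that G by (auto simp: string_tape_def bit_symbol_def G_def)
    have r: "(tm_step (widen K U) ^^ k) (0, ?us @ ?blank) = (num_states U, ts @ ?blank) \<and> length ts = num_tapes U"
    proof (rule exec_widen[OF U])
      show "(tm_step U ^^ k) (0, ?us) = (num_states U, ts)"
        using run by (simp add: initial_config_def b_def)
      show "u i < num_symbols U" if "u \<in> set ?us" for u i
        using that by (rule sym)
    qed (use b in \<open>auto simp: K_def b_def\<close>)
    then have e1: "exec (widen K U) (?us @ ?blank) (ts @ ?blank)" and ts: "length ts = b"
      by (auto simp: exec_def widen_def b_def)
    have "replicate R (counter_tape 0) = reg_tapes R (\<lambda>_. 0)"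
      by (intro nth_equalityI) auto
    then have e2: "exec (init_regs K G b R) (ts @ ?blank) (ts @ reg_tapes R (\<lambda>_. 0))"
      using exec_init_regs[OF ts, of R R K G] b by simp
    obtain us1 s1 where e3: "exec (read_loop K G b double t) (ts @ reg_tapes R (\<lambda>_. 0)) (us1 @ reg_tapes R s1)"
      and us1: "length us1 = b" "s1 0 = code y"
      using exec_read_loop[OF double R(1) _ _ ts y, of G "\<lambda>_. 0"] R(5) t
      by (auto simp: K_def b_def code_def)
    obtain s2 where s2: "runs main s1 s2" "s2 0 = code z" using main us1(2) z by metis
    have e4: "exec (machine K G b main) (us1 @ reg_tapes R s1) (us1 @ reg_tapes R s2)"
      unfolding K_def by (rule exec_machine[OF s2(1) us1(1) R(4)])
    let ?us2 = "us1[2 := act (us1 ! 2) (0, Stay)]"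
    have e5: "exec (tape_op K G 2 (\<lambda>_. (0, Stay))) (us1 @ reg_tapes R s2) (?us2 @ reg_tapes R s2)"
      using b us1 by (intro exec_tape_op_left) simp
    have "spells (?us2 ! 2) []" using b us1 by (simp add: spells_def)
    moreover have "2 < b" "length ?us2 = b" using b us1 by auto
    ultimately obtain us3 s3 where e6: "exec (write_loop K G b parity halve) (?us2 @ reg_tapes R s2) (us3 @ reg_tapes R s3)"
      and us3: "length us3 = b" "spells (us3 ! 2) z"
      using exec_write_loop[OF parity halve R(2,3,5), of b ?us2 "[]" s2 z G, OF _ _ _ s2(2)] by (auto simp: K_def)
    have "exec M (?us @ ?blank) (us3 @ reg_tapes R s3)"
      unfolding M_def by (intro exec_seq[OF e1] exec_seq[OF e2] exec_seq[OF e3] exec_seq[OF e4] exec_seq[OF e5] e6)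
    moreover have "?us @ ?blank = [string_tape p, string_tape x] @ replicate (num_tapes M - 2) (\<lambda>_. 0)"
      using b \<open>num_tapes M = K\<close> by (simp add: K_def flip: replicate_add)
    moreover have "(us3 @ reg_tapes R s3) ! 2 = us3 ! 2"
      using us3 b by (simp add: nth_append)
    ultimately show ?thesis
      using us3 unfolding computes_def initial_config_def exec_def by metis
  qed
  ultimately show ?thesis using that by blast
qed

section \<open>Linear recurrences\<close>

text \<open>
  Ring identities over the two-element field are needed in terms of \<open>+\<close> and \<open>*\<close>, not in terms of
  bit operations.
\<close>

declare add_bit_eq_xor [simp del] mult_bit_eq_and [simp del]

text \<open>
  Polynomials act on two-sided sequences, the indeterminate as the delay by one step. This makes the
  sequences a module over the polynomial ring, and \<open>filter_seq p a = 0\<close> is the linear recurrence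
  with coefficients \<open>p\<close>.
\<close>

definition filter_seq :: "'a::comm_ring_1 poly \<Rightarrow> (int \<Rightarrow> 'a) \<Rightarrow> int \<Rightarrow> 'a" where
  "filter_seq p a = (\<lambda>j. \<Sum>i\<le>degree p. coeff p i * a (j - int i))"

lemma filter_seq_altdef:
  assumes "degree p \<le> n"
  shows "filter_seq p a j = (\<Sum>i\<le>n. coeff p i * a (j - int i))"
proof -
  have "(\<Sum>i\<le>n. coeff p i * a (j - int i)) = (\<Sum>i\<le>degree p. coeff p i * a (j - int i))"
    using assms by (intro sum.mono_neutral_right) (auto simp: coeff_eq_0 not_le)
  then show ?thesis by (simp add: filter_seq_def)
qed

lemma filter_seq_0 [simp]: "filter_seq 0 a = (\<lambda>_. 0)"
  by (simp add: filter_seq_def)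

lemma filter_seq_zero [simp]: "filter_seq p (\<lambda>_. 0) = (\<lambda>_. 0)"
  by (simp add: filter_seq_def)

lemma filter_seq_pCons: "filter_seq (pCons c p) a j = c * a j + filter_seq p a (j - 1)"
proof -
  have "degree (pCons c p) \<le> Suc (degree p)" by (rule degree_pCons_le)
  then have "filter_seq (pCons c p) a j = (\<Sum>i\<le>Suc (degree p). coeff (pCons c p) i * a (j - int i))"
    by (rule filter_seq_altdef)
  then show ?thesis
    by (simp add: sum.atMost_Suc_shift filter_seq_def algebra_simps del: sum.atMost_Suc)
qed

lemma filter_seq_add: "filter_seq (p + q) a j = filter_seq p a j + filter_seq q a j"
proof -
  have "degree (p + q) \<le> max (degree p) (degree q)" by (rule degree_add_le_max)
  then show ?thesis
    using filter_seq_altdef[of p "max (degree p) (degree q)" a j]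
      filter_seq_altdef[of q "max (degree p) (degree q)" a j]
      filter_seq_altdef[of "p + q" "max (degree p) (degree q)" a j]
    by (simp add: sum.distrib algebra_simps)
qed

lemma filter_seq_smult: "filter_seq (Polynomial.smult c p) a j = c * filter_seq p a j"
  using filter_seq_altdef[OF degree_smult_le[of c p], of a j]
  by (simp add: filter_seq_def sum_distrib_left mult.assoc)

lemma filter_seq_diff: "filter_seq (p - q) a j = filter_seq p a j - filter_seq q a j"
  using filter_seq_add[of "p - q" q a j] by simp

lemma filter_seq_mult: "filter_seq (p * q) a = filter_seq p (filter_seq q a)"
proof (induction p)
  case (pCons c p)
  show ?case
    by (rule ext) (simp add: filter_seq_pCons filter_seq_add filter_seq_smult pCons)
qed auto

lemma filter_seq_add_right: "filter_seq p (\<lambda>j. a j + b j) j = filter_seq p a j + filter_seq p b j"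
  by (simp add: filter_seq_def algebra_simps sum.distrib)

lemma filter_seq_1 [simp]: "filter_seq 1 a = a"
  by (simp add: filter_seq_def fun_eq_iff)

lemma filter_seq_monom: "filter_seq (monom 1 k) a j = a (j - int k)"
proof -
  have "filter_seq (monom 1 k) a j = (\<Sum>i\<le>k. coeff (monom 1 k) i * a (j - int i))"
    by (rule filter_seq_altdef) (rule degree_monom_le)
  also have "\<dots> = (\<Sum>i\<le>k. if k = i then a (j - int i) else 0)"
    by (intro sum.cong) auto
  finally show ?thesis by simp
qed

lemma filter_seq_dvd: "p dvd q \<Longrightarrow> filter_seq p a = (\<lambda>_. 0) \<Longrightarrow> filter_seq q a = (\<lambda>_. 0)"
  by (auto elim!: dvdE simp: mult.commute[of p] filter_seq_mult)

text \<open>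
  Reversing a sequence turns a delay into an advance, that is, the indeterminate into its inverse;
  multiplication by the power \<open>degree p\<close> makes the result a polynomial again.
\<close>

lemma filter_seq_reflect:
  "filter_seq (reflect_poly p) (\<lambda>j. a (- j)) j = filter_seq p a (int (degree p) - j)"
proof -
  have "filter_seq (reflect_poly p) (\<lambda>j. a (- j)) j
      = (\<Sum>i\<le>degree p. coeff p (degree p - i) * a (int i - j))"
    by (subst filter_seq_altdef[OF degree_reflect_poly_le]) (simp add: coeff_reflect_poly)
  also have "\<dots> = (\<Sum>i\<le>degree p. coeff p i * a (int (degree p - i) - j))"
    by (rule sum.reindex_bij_witness[of _ "\<lambda>i. degree p - i" "\<lambda>i. degree p - i"]) auto
  also have "\<dots> = filter_seq p a (int (degree p) - j)"
    unfolding filter_seq_def by (intro sum.cong) (auto simp: of_nat_diff algebra_simps)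
  finally show ?thesis .
qed

lemma filter_seq_reflect_zero:
  "filter_seq p a = (\<lambda>_. 0) \<Longrightarrow> filter_seq (reflect_poly p) (\<lambda>j. a (- j)) = (\<lambda>_. 0)"
  by (rule ext) (simp add: filter_seq_reflect)

lemma filter_seq_commute: "filter_seq p (filter_seq q a) = filter_seq q (filter_seq p a)"
  by (simp add: mult.commute flip: filter_seq_mult)

text \<open>
  The polynomials that annihilate \<open>a\<close> form an ideal, generated by an element \<open>p\<close> of least degree. It
  is not a unit because \<open>a\<close> is not zero, so \<open>p\<close> is associated to the irreducible element \<open>f\<close>.
\<close>

lemma irreducible_dvd_annihilator:
  fixes f :: "'a::field poly"
  assumes f: "irreducible f" "filter_seq f a = (\<lambda>_. 0)" and g: "filter_seq g a = (\<lambda>_. 0)"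
    and a: "a \<noteq> (\<lambda>_. 0)"
  shows "f dvd g"
proof -
  define I where "I = {p. p \<noteq> 0 \<and> filter_seq p a = (\<lambda>_. 0)}"
  have "f \<in> I" using f by (auto simp: I_def)
  then obtain p where p: "p \<in> I" "\<And>q. q \<in> I \<Longrightarrow> degree p \<le> degree q"
    using ex_has_least_nat[of "\<lambda>p. p \<in> I" f degree] by blast
  have dvd: "p dvd q" if "filter_seq q a = (\<lambda>_. 0)" for q
  proof (rule ccontr)
    assume "\<not> p dvd q"
    then have nz: "q mod p \<noteq> 0" by (simp add: dvd_eq_mod_eq_0)
    have "filter_seq (q div p * p) a = (\<lambda>_. 0)"
      by (rule filter_seq_dvd[of p]) (use p(1) in \<open>auto simp: I_def\<close>)
    then have "filter_seq (q mod p) a = (\<lambda>_. 0)"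
      using that by (simp add: fun_eq_iff filter_seq_diff flip: minus_div_mult_eq_mod)
    then have "q mod p \<in> I" using nz by (simp add: I_def)
    then show False
      using p degree_mod_less'[of p q] nz by (fastforce simp: I_def)
  qed
  obtain r where r: "f = p * r" using dvd[OF f(2)] by (elim dvdE)
  have "\<not> is_unit p"
  proof
    assume "is_unit p"
    then have "filter_seq 1 a = (\<lambda>_. 0)"
      using p(1) by (intro filter_seq_dvd[of p 1]) (auto simp: I_def)
    then show False using a by simp
  qed
  then have "is_unit r" using r f(1) by (auto dest: irreducibleD)
  then have "f dvd p" using r by (metis mult_unit_dvd_iff dvd_refl)
  then show ?thesis using dvd[OF g] dvd_trans by blast
qed

lemma filter_seq_zero_of_dvd_same_degree:
  fixes f :: "'a::field poly"
  assumes "f dvd g" "g \<noteq> 0" "degree g \<le> degree f" "filter_seq g b = (\<lambda>_. 0)"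
  shows "filter_seq f b = (\<lambda>_. 0)"
proof -
  obtain q where q: "g = f * q" using assms(1) by (elim dvdE)
  then have "degree q = 0" using assms(2,3) by (auto simp: degree_mult_eq)
  then obtain c where c: "q = [:c:]" by (elim degree_eq_zeroE)
  have "c \<noteq> 0" using c q assms(2) by auto
  moreover have "c * filter_seq f b j = 0" for j
    using fun_cong[OF assms(4), of j] by (simp add: q c filter_seq_smult)
  ultimately show ?thesis by (simp add: fun_eq_iff)
qed

lemma bit_add_self [simp]: "(x :: bit) + x = 0"
  by (cases x) simp_all

lemma bit_add_self_left [simp]: "(x :: bit) + (x + y) = y"
  by (simp flip: add.assoc)

lemma bit_diff [simp]: "(x :: bit) - y = x + y"
  by (cases x; cases y) simp_all

lemma bit_add_eq_0_iff: "(x :: bit) + y = 0 \<longleftrightarrow> x = y"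
  by (cases x; cases y) simp_all

lemma primitive_coeff_0:
  assumes "primitive_poly f"
  shows "coeff f 0 \<noteq> 0"
proof
  assume "coeff f 0 = 0"
  then obtain q where q: "f = [:0, 1:] * q"
    by (metis dvdE poly_0_coeff_0 poly_eq_0_iff_dvd minus_zero)
  moreover have "\<not> is_unit ([:0, 1:] :: bit poly)"
    by (simp add: is_unit_iff_degree)
  ultimately have "is_unit q"
    using assms irreducibleD unfolding primitive_poly_def by blast
  then have "f dvd [:0, 1:]" unfolding q by (metis mult_unit_dvd_iff dvd_refl)
  then show False using assms by (simp add: primitive_poly_def monom_altdef)
qed

text \<open>
  If \<open>f\<close> divided its reciprocal, the two would be equal, and \<open>f\<close> would annihilate both \<open>a\<close> and the
  reversal of \<open>a\<close>. By primitivity \<open>1 + x\<close> is congruent to some power \<open>x ^ k\<close> modulo \<open>f\<close>, so that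
  \<open>a j + a (j - 1) = a (j - k)\<close> for all \<open>j\<close>, and likewise for the reversal. Eliminating \<open>k\<close> leaves a
  recurrence of order 2 for \<open>a\<close>, which is impossible for \<open>degree f \<ge> 3\<close>.
\<close>

lemma primitive_not_dvd_reflect:
  assumes f: "primitive_poly f" "degree f \<ge> 3"
    and a: "filter_seq f a = (\<lambda>_. 0)" "a \<noteq> (\<lambda>_. 0)"
  shows "\<not> f dvd reflect_poly f"
proof
  assume dvd: "f dvd reflect_poly f"
  have f0: "f \<noteq> 0" and irr: "irreducible f" using f(1) by (auto simp: primitive_poly_def)
  have ar: "filter_seq f (\<lambda>j. a (- j)) = (\<lambda>_. 0)"
    by (rule filter_seq_zero_of_dvd_same_degree[OF dvd])
      (use f0 in \<open>auto simp: filter_seq_reflect_zero[OF a(1)] degree_reflect_poly_le\<close>)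
  have small: "\<not> f dvd p" if "p \<noteq> 0" "degree p \<le> 2" for p
    using dvd_imp_degree_le[of f p] that f(2) by auto
  have "\<not> f dvd [:1, 1:]" by (rule small) auto
  then obtain k where k: "f dvd [:1, 1:] - monom 1 k"
    using f(1) unfolding primitive_poly_def by blast
  have zech: "b j + b (j - 1) = b (j - int k)" if "filter_seq f b = (\<lambda>_. 0)" for b j
    using fun_cong[OF filter_seq_dvd[OF k that], of j]
    by (simp add: filter_seq_diff filter_seq_pCons filter_seq_monom bit_add_eq_0_iff)
  have "a j + (a (j - 1) + a (j - 2)) = 0" for j
  proof -
    have "a (j - 1 + int k) + a (j - 2 + int k) = a (j - 1)"
      using zech[OF a(1), of "j - 1 + int k"] by (simp add: algebra_simps)
    moreover have "a (j - 1) + a j = a (j - 1 + int k)"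
      using zech[OF ar, of "1 - j"] by (simp add: algebra_simps)
    moreover have "a (j - 2) + a (j - 1) = a (j - 2 + int k)"
      using zech[OF ar, of "2 - j"] by (simp add: algebra_simps)
    ultimately show ?thesis
      by (metis add.assoc add.commute bit_add_self_left bit_add_eq_0_iff)
  qed
  then have "filter_seq [:1, 1, 1:] a = (\<lambda>_. 0)"
    by (simp add: filter_seq_pCons fun_eq_iff)
  from irreducible_dvd_annihilator[OF irr a(1) this a(2)] small[of "[:1, 1, 1:]"] show False by simp
qed

text \<open>
  Why a word can be recovered up to reversal from the sums of opposite entries. The product \<open>h\<close> of
  \<open>g\<close> and its reciprocal annihilates \<open>b\<close> and the reversal of \<open>b\<close>, hence the common symmetrisation.
  So it maps \<open>a\<close> and the reversal of \<open>a\<close> to the same sequence, which \<open>f\<close> and its reciprocal both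
  annihilate and which is therefore zero.
\<close>

theorem reversal_sum_determines:
  assumes f: "primitive_poly f" "degree f \<ge> 3"
    and a: "filter_seq f a = (\<lambda>_. 0)" "a \<noteq> (\<lambda>_. 0)"
    and g: "g \<noteq> 0" "degree g \<le> degree f" "filter_seq g b = (\<lambda>_. 0)"
    and sum: "\<And>j. b j + b (- j) = a j + a (- j)"
  shows "b = a \<or> b = (\<lambda>j. a (- j))"
proof -
  have f0: "f \<noteq> 0" and irr: "irreducible f" using f(1) by (auto simp: primitive_poly_def)
  have coprime: "u = (\<lambda>_. 0)"
    if "filter_seq f u = (\<lambda>_. 0)" "filter_seq (reflect_poly f) u = (\<lambda>_. 0)" for u
    using irreducible_dvd_annihilator[OF irr that] primitive_not_dvd_reflect[OF f a] by blast
  \<comment> \<open>\<open>c + a\<close> is its own reversal, so the reciprocal of \<open>f\<close> annihilates it too.\<close>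
  have same: "c = a" if c: "filter_seq f c = (\<lambda>_. 0)" "\<And>j. c j + c (- j) = a j + a (- j)" for c
  proof -
    have ext: "c j + a j = c (- j) + a (- j)" for j
      using c(2)[of j] by (metis add.assoc add.commute bit_add_self_left)
    have z: "filter_seq f (\<lambda>j. c j + a j) = (\<lambda>_. 0)"
      using c(1) a(1) by (simp add: fun_eq_iff filter_seq_add_right)
    have "filter_seq (reflect_poly f) (\<lambda>j. c j + a j) = (\<lambda>_. 0)"
      using filter_seq_reflect_zero[OF z] ext by simp
    from coprime[OF z this] show ?thesis by (simp add: fun_eq_iff bit_add_eq_0_iff)
  qed
  define h where "h = g * reflect_poly g"
  let ?ra = "\<lambda>j. a (- j)" and ?rb = "\<lambda>j. b (- j)"
  have gr: "filter_seq (reflect_poly g) ?rb = (\<lambda>_. 0)"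
    by (rule filter_seq_reflect_zero) fact
  have "filter_seq h b = (\<lambda>_. 0)" "filter_seq h ?rb = (\<lambda>_. 0)"
    using g(3) gr by (auto simp: h_def filter_seq_mult filter_seq_commute[of g])
  then have "filter_seq h (\<lambda>j. b j + b (- j)) = (\<lambda>_. 0)"
    by (simp add: fun_eq_iff filter_seq_add_right)
  then have "filter_seq h (\<lambda>j. a j + a (- j)) = (\<lambda>_. 0)"
    by (simp only: sum)
  then have u: "filter_seq h a = filter_seq h ?ra"
    by (simp add: fun_eq_iff filter_seq_add_right bit_add_eq_0_iff)
  have "filter_seq h a = (\<lambda>_. 0)"
  proof (rule coprime)
    show "filter_seq f (filter_seq h a) = (\<lambda>_. 0)"
      by (simp add: filter_seq_commute[of f] a(1))
    show "filter_seq (reflect_poly f) (filter_seq h a) = (\<lambda>_. 0)"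
      unfolding u by (simp add: filter_seq_commute[of "reflect_poly f"] filter_seq_reflect_zero[OF a(1)])
  qed
  then have "f dvd h" by (rule irreducible_dvd_annihilator[OF irr a(1) _ a(2)])
  then have "f dvd g \<or> f dvd reflect_poly g"
    unfolding h_def using field_poly_irreducible_imp_prime[OF irr] by (simp add: prime_elem_dvd_mult_iff)
  then show ?thesis
  proof
    assume "f dvd g"
    from filter_seq_zero_of_dvd_same_degree[OF this g] same[of b] sum show ?thesis by blast
  next
    assume "f dvd reflect_poly g"
    from filter_seq_zero_of_dvd_same_degree[OF this _ _ gr] g(1,2) degree_reflect_poly_le[of g]
    have "?rb = a" using sum by (intro same) (auto simp: add.commute)
    then show ?thesis by (metis minus_minus)
  qed
qed

section \<open>Golomb sequences\<close>

lemma degree_less_eq_Poly_image: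
  "m > 0 \<Longrightarrow> {p. degree p < m} = Poly ` {xs. set xs \<subseteq> UNIV \<and> length xs = m}"
proof (intro equalityI subsetI)
  fix p :: "'a poly" assume m: "m > 0" and "p \<in> {p. degree p < m}"
  then have "coeff p i = 0" if "i \<ge> m" for i using that by (auto intro: coeff_eq_0)
  then have "p = Poly (map (coeff p) [0..<m])"
    by (auto intro!: poly_eqI simp: nth_default_def)
  then show "p \<in> Poly ` {xs. set xs \<subseteq> UNIV \<and> length xs = m}" by force
next
  fix p :: "'a poly" assume m: "m > 0" and "p \<in> Poly ` {xs. set xs \<subseteq> UNIV \<and> length xs = m}"
  then show "p \<in> {p. degree p < m}"
    using degree_Poly[of _ ] by (auto intro!: degree_lessI simp: nth_default_def)
qed

lemma card_degree_less:
  assumes "m > 0"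
  shows "finite {p :: bit poly. degree p < m}" "card {p :: bit poly. degree p < m} = 2 ^ m"
proof -
  have U: "(UNIV :: bit set) = {0, 1}" by (auto intro: bit.exhaust)
  have fin: "finite (UNIV :: bit set)" unfolding U by simp
  have card: "card (UNIV :: bit set) = 2" unfolding U by simp
  show "finite {p :: bit poly. degree p < m}"
    unfolding degree_less_eq_Poly_image[OF assms] using finite_lists_length_eq[OF fin] by blast
  have "inj_on Poly {xs :: bit list. set xs \<subseteq> UNIV \<and> length xs = m}"
  proof (rule inj_onI)
    fix xs ys :: "bit list"
    assume "xs \<in> {xs. set xs \<subseteq> UNIV \<and> length xs = m}" "ys \<in> {xs. set xs \<subseteq> UNIV \<and> length xs = m}"
      and eq: "Poly xs = Poly ys"
    then have l: "length xs = m" "length ys = m" by auto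
    have "nth_default 0 xs i = nth_default 0 ys i" for i
      using arg_cong[OF eq, of "\<lambda>p. coeff p i"] by simp
    then show "xs = ys" using l by (metis nth_default_nth nth_equalityI)
  qed
  then show "card {p :: bit poly. degree p < m} = 2 ^ m"
    unfolding degree_less_eq_Poly_image[OF assms]
    using card_lists_length_eq[OF fin, of m] card by (simp add: card_image)
qed

text \<open>
  Let \<open>t\<close> be the order of \<open>x\<close> modulo \<open>f\<close>. The powers \<open>x ^ k\<close> for \<open>k < t\<close> are distinct residues, and
  by primitivity they exhaust the \<open>2 ^ degree f - 1\<close> non-zero ones.
\<close>

lemma primitive_dvd:
  assumes f: "primitive_poly f"
  shows "f dvd monom 1 (2 ^ degree f - 1) - 1"
proof -
  let ?m = "degree f"
  have irr: "irreducible f" and f0: "f \<noteq> 0" using f by (auto simp: primitive_poly_def)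
  have m: "?m > 0" using irr f0 is_unit_iff_degree[OF f0] by (auto simp: irreducible_def)
  have prime: "prime_elem f" by (rule field_poly_irreducible_imp_prime[OF irr])
  have x: "\<not> f dvd monom 1 k" for k
  proof
    assume "f dvd monom 1 k"
    then have "f dvd monom 1 1 ^ k" by (simp add: monom_power)
    then show False using prime f prime_elem_dvd_power by (auto simp: primitive_poly_def)
  qed
  let ?r = "\<lambda>k. monom 1 k mod f :: bit poly"
  let ?A = "{p :: bit poly. degree p < ?m}"
  have diff: "f dvd monom 1 (j - i) - 1" if "?r i = ?r j" "i \<le> j" for i j
  proof -
    have "f dvd monom 1 j - monom 1 i" using that by (metis mod_eq_dvd_iff)
    moreover have "monom 1 j - monom 1 i = monom 1 i * (monom 1 (j - i) - 1 :: bit poly)"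
      using that(2) by (simp add: algebra_simps mult_monom)
    ultimately show ?thesis using prime x by (auto simp: prime_elem_dvd_mult_iff)
  qed
  have r_in: "?r k \<in> ?A - {0}" for k
  proof -
    have "?r k \<noteq> 0" using x[of k] by (simp only: dvd_eq_mod_eq_0 not_False_eq_True)
    then show ?thesis using degree_mod_less[OF f0, of "monom 1 k"] by auto
  qed
  have fin: "finite (?A - {0})" using card_degree_less(1)[OF m] by simp
  have "\<not> inj ?r"
  proof
    assume "inj ?r"
    moreover have "finite (range ?r)" by (intro finite_subset[OF image_subsetI fin] r_in)
    ultimately show False using finite_imageD infinite_UNIV_nat by blast
  qed
  then obtain i j where "?r i = ?r j" "i < j"
    unfolding inj_def by (metis linorder_neqE_nat)
  then have ex: "j - i > 0 \<and> f dvd monom 1 (j - i) - 1" using diff[of i j] by simp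
  define t where "t = (LEAST t. t > 0 \<and> f dvd monom 1 t - 1)"
  have t: "t > 0" "f dvd monom 1 t - 1"
    using LeastI[of "\<lambda>t. t > 0 \<and> f dvd monom 1 t - 1", OF ex] by (auto simp: t_def)
  have t_min: "\<not> f dvd monom 1 s - 1" if "0 < s" "s < t" for s
    using that not_less_Least by (auto simp: t_def)
  have "inj_on ?r {..<t}"
  proof (rule linorder_inj_onI)
    fix i j assume ij: "i < j" "i \<in> {..<t}" "j \<in> {..<t}"
    show "?r i \<noteq> ?r j"
    proof
      assume "?r i = ?r j"
      then have "f dvd monom 1 (j - i) - 1" using diff ij by simp
      moreover have "0 < j - i" "j - i < t" using ij by auto
      ultimately show False using t_min by blast
    qed
  qed auto
  moreover have "?r ` {..<t} = ?A - {0}"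
  proof (intro equalityI subsetI)
    fix p assume p: "p \<in> ?A - {0}"
    then have "\<not> f dvd p" using dvd_imp_degree_le[of f p] by auto
    then obtain k where "f dvd p - monom 1 k" using f by (auto simp: primitive_poly_def)
    then have "p mod f = ?r k" by (simp add: mod_eq_dvd_iff)
    moreover have "p mod f = p" using p by (auto intro: mod_poly_less)
    moreover have "?r k = ?r (k mod t)"
    proof -
      have "(monom 1 t :: bit poly) mod f = 1 mod f" using t(2) by (simp add: mod_eq_dvd_iff)
      then have "monom 1 t ^ (k div t) mod f = (1 :: bit poly) mod f"
        by (metis power_mod power_one)
      then have "monom 1 t ^ (k div t) * monom 1 (k mod t) mod f = 1 * monom 1 (k mod t) mod f"
        by (metis mod_mult_left_eq)
      then show ?thesis by (simp add: monom_power mult_monom)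
    qed
    ultimately have "p = ?r (k mod t)" by simp
    then show "p \<in> ?r ` {..<t}" using t(1) by (intro image_eqI[of _ _ "k mod t"]) simp_all
  next
    fix p assume "p \<in> ?r ` {..<t}"
    then obtain k where "p = ?r k" by (rule imageE)
    then show "p \<in> ?A - {0}" by (simp only: r_in)
  qed
  ultimately have "t = card (?A - {0})" by (metis card_image card_lessThan)
  also have "\<dots> = 2 ^ ?m - 1" using card_degree_less[OF m] m by (simp add: card_Diff_singleton)
  finally show ?thesis using t(2) by simp
qed

text \<open>
  The codeword, repeated periodically, is \<open>Poly c\<close> applied to the sequence \<open>\<delta>\<close> that is 1 exactly at
  the multiples of \<open>n\<close>. The polynomial \<open>monom 1 n - 1\<close> annihilates \<open>\<delta>\<close> and divides \<open>f * Poly c\<close>.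
\<close>

lemma filter_seq_golomb:
  assumes f: "primitive_poly f" and c: "c \<in> golomb_sequences f"
  shows "length c = 2 ^ degree f - 1" "filter_seq f (periodic c) = (\<lambda>_. 0)" "periodic c \<noteq> (\<lambda>_. 0)"
proof -
  define n where "n = length c"
  show len: "length c = 2 ^ degree f - 1"
    using c by (auto simp: golomb_sequences_def simplex_code_def Let_def)
  have h: "(monom 1 n - 1) div f dvd Poly c"
    using c len by (auto simp: golomb_sequences_def simplex_code_def Let_def n_def)
  obtain a where a: "a \<in> set c" "a \<noteq> 0" using c by (auto simp: golomb_sequences_def)
  then have n: "n > 0" by (auto simp: n_def)
  define \<delta> :: "int \<Rightarrow> bit" where "\<delta> j = of_bool (j mod int n = 0)" for j
  have \<delta>: "filter_seq (monom 1 n - 1) \<delta> = (\<lambda>_. 0)"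
    by (simp add: fun_eq_iff filter_seq_diff filter_seq_monom \<delta>_def)
  have "filter_seq (Poly c) \<delta> j = periodic c j" for j
  proof -
    have "degree (Poly c) \<le> n"
      using degree_Poly[of c] by (simp add: n_def)
    then have "filter_seq (Poly c) \<delta> j = (\<Sum>i\<le>n. nth_default 0 c i * \<delta> (j - int i))"
      by (simp add: filter_seq_altdef)
    also have "\<dots> = (\<Sum>i\<le>n. if i = nat (j mod int n) then nth_default 0 c i else 0)"
    proof (intro sum.cong refl)
      fix i assume "i \<in> {..n}"
      show "nth_default 0 c i * \<delta> (j - int i) = (if i = nat (j mod int n) then nth_default 0 c i else 0)"
      proof (cases "i = n")
        case True
        then show ?thesis by (simp add: nth_default_def n_def)
      next
        case False
        then have "i < n" using \<open>i \<in> {..n}\<close> by simp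
        then have "(j - int i) mod int n = 0 \<longleftrightarrow> j mod int n = int i"
          by (metis mod_eq_dvd_iff dvd_eq_mod_eq_0 zmod_int mod_less)
        also have "\<dots> \<longleftrightarrow> i = nat (j mod int n)" using n by auto
        finally show ?thesis by (simp add: \<delta>_def)
      qed
    qed
    also have "\<dots> = nth_default 0 c (nat (j mod int n))"
      using n by (simp add: nat_le_iff less_imp_le)
    also have "\<dots> = periodic c j"
      using n by (simp add: periodic_def nth_default_def n_def nat_less_iff)
    finally show ?thesis .
  qed
  then have c\<delta>: "periodic c = filter_seq (Poly c) \<delta>" by (rule ext[symmetric])
  have "monom 1 n - 1 dvd f * Poly c"
  proof -
    have "f * ((monom 1 n - 1) div f) = monom 1 n - 1"
      using primitive_dvd[OF f] len by (intro dvd_mult_div_cancel) (simp add: n_def)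
    then show ?thesis using mult_dvd_mono[OF dvd_refl[of f] h] by simp
  qed
  from filter_seq_dvd[OF this \<delta>] show "filter_seq f (periodic c) = (\<lambda>_. 0)"
    by (simp add: c\<delta> filter_seq_mult)
  obtain i where "i < n" "c ! i = a" using a(1) by (auto simp: in_set_conv_nth n_def)
  then have "periodic c (int i) = a" by (simp add: periodic_def n_def flip: zmod_int)
  then show "periodic c \<noteq> (\<lambda>_. 0)" using a(2) by auto
qed

lemma recurrence_initial_values:
  fixes f :: "bit poly"
  assumes f: "coeff f 0 \<noteq> 0" "degree f = m"
    and a: "filter_seq f a = (\<lambda>_. 0)" and b: "filter_seq f b = (\<lambda>_. 0)"
    and init: "\<And>i. i < m \<Longrightarrow> a (int i) = b (int i)"
  shows "a (int k) = b (int k)"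
proof (induction k rule: less_induct)
  case (less k)
  show ?case
  proof (cases "k < m")
    case False
    have s: "coeff f 0 * c (int k) = (\<Sum>i<m. coeff f (Suc i) * c (int (k - Suc i)))"
      if "filter_seq f c = (\<lambda>_. 0)" for c
    proof -
      have "0 = (\<Sum>i\<le>m. coeff f i * c (int k - int i))"
        using fun_cong[OF that, of "int k"] f(2) by (simp add: filter_seq_def)
      also have "\<dots> = coeff f 0 * c (int k) + (\<Sum>i<m. coeff f (Suc i) * c (int k - int (Suc i)))"
        by (subst sum.atMost_shift) simp
      also have "(\<Sum>i<m. coeff f (Suc i) * c (int k - int (Suc i)))
          = (\<Sum>i<m. coeff f (Suc i) * c (int (k - Suc i)))"
        using False by (intro sum.cong refl) (simp add: of_nat_diff)
      finally show ?thesis by (metis bit_add_eq_0_iff)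
    qed
    have "(\<Sum>i<m. coeff f (Suc i) * a (int (k - Suc i))) = (\<Sum>i<m. coeff f (Suc i) * b (int (k - Suc i)))"
      using False by (intro sum.cong refl arg_cong2[where f = "(*)"] less.IH) auto
    then have "coeff f 0 * a (int k) = coeff f 0 * b (int k)"
      by (simp only: s[OF a] s[OF b])
    then show ?thesis using f(1) by simp
  qed (simp add: init)
qed

section \<open>Maps between words, sign patterns and seeds\<close>

lemma length_encode_word [simp]: "length (encode_word c) = length c"
  by (simp add: encode_word_def)

lemma encode_word_of_bool [simp]: "encode_word (map of_bool z) = z"
  by (simp add: encode_word_def comp_def)

lemma bit_eq_of_bool: "(b :: bit) = of_bool (b = 1)"
  by (cases b) simp_all

lemma periodic_cong:
  "j mod int (length c) = k mod int (length c) \<Longrightarrow> periodic c j = periodic c k"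
  by (simp add: periodic_def)

lemma periodic_eq_nth: "i < length c \<Longrightarrow> periodic c (int i) = c ! i"
  by (simp add: periodic_def flip: zmod_int)

lemma nth_encode_word: "i < length c \<Longrightarrow> encode_word c ! i \<longleftrightarrow> periodic c (int i) = 1"
  by (simp add: periodic_eq_nth) (simp add: encode_word_def)

lemma code_digit_word:
  assumes "i < length c"
  shows "code_digit (code (encode_word c)) i \<longleftrightarrow> periodic c (int i) = 1"
  using assms by (simp add: periodic_eq_nth) (simp add: encode_word_def)

lemma code_digit_word_mod:
  assumes "length c > 0" "int k mod int (length c) = j mod int (length c)"
  shows "code_digit (code (encode_word c)) (k mod length c) \<longleftrightarrow> periodic c j = 1"
proof -
  have "periodic c (int (k mod length c)) = periodic c j"
    by (rule periodic_cong) (use assms(2) in \<open>simp add: zmod_int\<close>)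
  then show ?thesis using code_digit_word[of "k mod length c" c] assms(1) by simp
qed

lemma of_nat_bit_eq_0_iff: "(of_nat k :: bit) = 0 \<longleftrightarrow> even k"
proof (induction k)
  case (Suc k)
  then show ?case by (cases "of_nat k :: bit") auto
qed simp

text \<open>
  The maps between codes of words that the machines apply. Differences of positions modulo \<open>n\<close> are
  kept non-negative by adding \<open>n\<close>.
\<close>

definition sign_digit :: "nat \<Rightarrow> nat \<Rightarrow> bool" where
  "sign_digit N k \<longleftrightarrow>
     code_digit N ((k div code_length N + code_length N - k mod code_length N) mod code_length N) \<noteq>
     code_digit N ((k mod code_length N + code_length N - k div code_length N) mod code_length N)"

definition sign_code :: "nat \<Rightarrow> nat" where
  "sign_code N = code (map (sign_digit N) [0..<code_length N * code_length N])"

text \<open>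
  The word with code \<open>W\<close> has length \<open>n\<close> and is read cyclically, the first \<open>m + 1\<close> digits of \<open>F\<close> are
  the coefficients of the recurrence. The index \<open>j + (n - 1) * i\<close> is \<open>j - i\<close> modulo \<open>n\<close>.
\<close>

definition recurrence_holds :: "nat \<Rightarrow> nat \<Rightarrow> nat \<Rightarrow> nat \<Rightarrow> bool" where
  "recurrence_holds m n F W \<longleftrightarrow>
     (\<forall>j<n. even (\<Sum>i<Suc m. of_bool (code_digit F i \<and> code_digit W ((j + (n - 1) * i) mod n)) :: nat))"

definition generated_code :: "nat \<Rightarrow> nat \<Rightarrow> nat \<Rightarrow> nat" where
  "generated_code m n N = least_below (2 ^ (n + 1)) (\<lambda>W. code_length W = n \<and> recurrence_holds m n N W \<and>
     (\<forall>i<m. code_digit W i \<longleftrightarrow> code_digit N (Suc m + i)))"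

text \<open>
  The argument codes \<open>2 * m + 1\<close> bits, the coefficients of the recurrence followed by initial values;
  rounding down in the division by 2 yields \<open>m\<close>.
\<close>

definition generate_code :: "nat \<Rightarrow> nat" where
  "generate_code N = generated_code (code_length N div 2) (2 ^ (code_length N div 2) - 1) N"

text \<open>
  A sign pattern has \<open>n * n\<close> entries and \<open>n = 2 ^ m - 1\<close>; these functions recover \<open>n\<close> and \<open>m\<close>.
\<close>

definition side :: "nat \<Rightarrow> nat" where
  "side N = least_below (code_length N + 1) (\<lambda>k. code_length N \<le> k * k)"

definition side_degree :: "nat \<Rightarrow> nat" where
  "side_degree N = least_below (side N + 1) (\<lambda>k. side N < 2 ^ k)"

text \<open>
  The last clause compares \<open>W\<close> with row 0 of the sign pattern, whose entry \<open>j\<close> shows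
  \<open>\<phi>(-j) + \<phi>(j)\<close>. The code of a word of length \<open>m + 1\<close> is less than \<open>2 ^ (m + 2)\<close>.
\<close>

definition candidate :: "nat \<Rightarrow> nat \<Rightarrow> nat \<Rightarrow> nat \<Rightarrow> bool" where
  "candidate m n N W \<longleftrightarrow> code_length W = n \<and>
     (\<exists>F<2 ^ (m + 2). (\<exists>i<Suc m. code_digit F i) \<and> code_length F = Suc m \<and> recurrence_holds m n F W) \<and>
     (\<forall>j<n. code_digit N j \<longleftrightarrow> code_digit W j \<noteq> code_digit W ((n - j) mod n))"

definition recovered_code :: "nat \<Rightarrow> nat" where
  "recovered_code N = least_below (2 ^ (side N + 1)) (\<lambda>W. candidate (side_degree N) (side N) N W)"

definition reversed_code :: "nat \<Rightarrow> nat \<Rightarrow> nat" where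
  "reversed_code n W = code (map (\<lambda>i. code_digit W ((n - i) mod n)) [0..<n])"

definition recovered_reversed_code :: "nat \<Rightarrow> nat" where
  "recovered_reversed_code N = reversed_code (side N) (recovered_code N)"

lemma prim_sign_code: "prim (\<lambda>e. sign_code (e 0))"
  unfolding sign_code_def sign_digit_def by (intro prim_intros)

lemma prim_generate_code: "prim (\<lambda>e. generate_code (e 0))"
  unfolding generate_code_def generated_code_def recurrence_holds_def by (intro prim_intros)

lemma prim_side: "prim f \<Longrightarrow> prim (\<lambda>e. side (f e))"
  unfolding side_def by (rule prim_comp) (intro prim_intros)

lemma prim_side_degree: "prim f \<Longrightarrow> prim (\<lambda>e. side_degree (f e))"
  unfolding side_degree_def by (rule prim_comp) (intro prim_intros prim_side)

lemma prim_recovered_code: "prim (\<lambda>e. recovered_code (e 0))"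
  unfolding recovered_code_def candidate_def recurrence_holds_def
  by (intro prim_side prim_side_degree prim_intros)

lemma prim_recovered_reversed_code: "prim (\<lambda>e. recovered_reversed_code (e 0))"
  unfolding recovered_reversed_code_def reversed_code_def
  by (intro prim_side prim_comp[OF prim_recovered_code] prim_intros)

lemma concat_map_upt:
  "concat (map (\<lambda>i. map (g i) [0..<n]) [0..<r]) = map (\<lambda>k. g (k div n) (k mod n)) [0..<r * n]"
proof (induction r)
  case (Suc r)
  have "map (g r) [0..<n] = map (\<lambda>k. g (k div n) (k mod n)) [r * n..<r * n + n]"
    by (intro nth_equalityI) (auto simp: div_mult_self1)
  moreover have "Suc r * n = r * n + n" by simp
  then have "[0..<Suc r * n] = [0..<r * n] @ [r * n..<r * n + n]"
    by (simp only: upt_add_eq_append[OF le0])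
  moreover have "[0..<Suc r] = [0..<r] @ [r]" by simp
  ultimately show ?case using Suc by (simp only: map_append concat_append list.map concat.simps append_Nil2)
qed simp

lemma sign_pattern_golomb_matrix:
  assumes "length c = n" "n > 0"
  shows "sign_pattern (golomb_matrix c) = map (\<lambda>k.
    (periodic c (int (k div n) - int (k mod n)) = 1) \<noteq> (periodic c (int (k mod n) - int (k div n)) = 1)) [0..<n * n]"
proof -
  have s: "1 / (2 * sqrt (real n)) * (- 1) ^ (of_bool P + of_bool Q) < 0 \<longleftrightarrow> P \<noteq> Q" for P Q
    using assms(2) by (cases P; cases Q) (simp_all add: field_simps)
  have "sign_pattern (golomb_matrix c) = concat (map (\<lambda>i. map (\<lambda>j.
      (periodic c (int i - int j) = 1) \<noteq> (periodic c (int j - int i) = 1)) [0..<n]) [0..<n])"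
    unfolding sign_pattern_def golomb_matrix_def Let_def assms(1)
    by (intro arg_cong[where f = concat] map_cong) (auto simp: s simp del: power_add)
  then show ?thesis by (simp only: concat_map_upt)
qed

lemma sign_code:
  assumes "length c > 0"
  shows "sign_code (code (encode_word c)) = code (sign_pattern (golomb_matrix c))"
proof -
  let ?n = "length c"
  have digit: "code_digit (code (encode_word c)) ((i + ?n - j) mod ?n) \<longleftrightarrow> periodic c (int i - int j) = 1"
    if "j < ?n" for i j
  proof (rule code_digit_word_mod[OF assms])
    have "int (i + ?n - j) = (int i - int j) + int ?n" using that by (simp add: of_nat_diff)
    then show "int (i + ?n - j) mod int ?n = (int i - int j) mod int ?n"
      by (simp only: mod_add_self2)
  qed
  have "sign_digit (code (encode_word c)) k \<longleftrightarrow>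
      (periodic c (int (k div ?n) - int (k mod ?n)) = 1) \<noteq> (periodic c (int (k mod ?n) - int (k div ?n)) = 1)"
    if "k < ?n * ?n" for k
  proof -
    have "k mod ?n < ?n" "k div ?n < ?n"
      using assms that by (simp_all add: less_mult_imp_div_less)
    then show ?thesis
      by (simp only: sign_digit_def code_length length_encode_word digit)
  qed
  then have "map (sign_digit (code (encode_word c))) [0..<?n * ?n] = sign_pattern (golomb_matrix c)"
    unfolding sign_pattern_golomb_matrix[OF refl assms] by (intro map_cong) auto
  then show ?thesis by (simp add: sign_code_def)
qed

lemma recurrence_holds_iff:
  assumes c: "length c = n" "n > 0" and p: "Suc m \<le> length p"
  shows "recurrence_holds m n (code p) (code (encode_word c)) \<longleftrightarrow>
    filter_seq (Poly (map of_bool (take (Suc m) p))) (periodic c) = (\<lambda>_. 0)"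
proof -
  let ?g = "Poly (map of_bool (take (Suc m) p)) :: bit poly"
  have coeff: "coeff ?g i = of_bool (p ! i)" if "i < Suc m" for i
    using that p by (simp add: nth_default_def)
  have deg: "degree ?g \<le> m"
    using degree_Poly[of "map of_bool (take (Suc m) p) :: bit list"] p
    by (auto intro!: degree_le simp: nth_default_def)
  have shift: "filter_seq ?g (periodic c) (j mod int n) = filter_seq ?g (periodic c) j" for j
    unfolding filter_seq_def
    by (intro sum.cong refl arg_cong2[where f = "(*)"] periodic_cong) (simp add: c(1) mod_diff_left_eq)
  have local: "filter_seq ?g (periodic c) (int j) = 0 \<longleftrightarrow>
      even (\<Sum>i<Suc m. of_bool (code_digit (code p) i \<and> code_digit (code (encode_word c)) ((j + (n - 1) * i) mod n)) :: nat)" for j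
  proof -
    have "coeff ?g i * periodic c (int j - int i)
        = of_nat (of_bool (code_digit (code p) i \<and> code_digit (code (encode_word c)) ((j + (n - 1) * i) mod n)))"
      if "i < Suc m" for i
    proof -
      have "int (j + (n - 1) * i) = int j - int i + int n * int i"
        using c(2) by (cases n) (simp_all add: algebra_simps)
      then have "int (j + (n - 1) * i) mod int n = (int j - int i) mod int n"
        by (simp only: mod_mult_self2)
      then have "code_digit (code (encode_word c)) ((j + (n - 1) * i) mod n) \<longleftrightarrow> periodic c (int j - int i) = 1"
        using code_digit_word_mod[of c "j + (n - 1) * i" "int j - int i"] unfolding c(1) using c(2) by blast
      then show ?thesis
        using that p coeff[OF that] by (cases "periodic c (int j - int i)") simp_all
    qed
    then have "filter_seq ?g (periodic c) (int j)
        = of_nat (\<Sum>i<Suc m. of_bool (code_digit (code p) i \<and> code_digit (code (encode_word c)) ((j + (n - 1) * i) mod n)))"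
      unfolding filter_seq_altdef[OF deg] of_nat_sum lessThan_Suc_atMost[symmetric]
      by (intro sum.cong) auto
    then show ?thesis by (simp only: of_nat_bit_eq_0_iff)
  qed
  have "filter_seq ?g (periodic c) = (\<lambda>_. 0) \<longleftrightarrow> (\<forall>j<n. filter_seq ?g (periodic c) (int j) = 0)"
  proof
    assume *: "\<forall>j<n. filter_seq ?g (periodic c) (int j) = 0"
    show "filter_seq ?g (periodic c) = (\<lambda>_. 0)"
    proof
      fix j
      have "int (nat (j mod int n)) = j mod int n" "nat (j mod int n) < n"
        using c(2) by (auto simp: nat_less_iff)
      then show "filter_seq ?g (periodic c) j = 0"
        using * shift[of j] by metis
    qed
  qed simp
  then show ?thesis by (simp only: local recurrence_holds_def)
qed

lemma word_of_code:
  obtains c :: "bit list" where "W = code (encode_word c)" "length c = code_length W"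
proof -
  obtain z where "code z = W" using code_surj by blast
  then show ?thesis using that[of "map of_bool z"] by auto
qed

lemma periodic_determines:
  assumes "length c = length d" "\<And>i. i < length c \<Longrightarrow> periodic c (int i) = periodic d (int i)"
  shows "c = d"
  using assms by (intro nth_equalityI) (auto simp flip: periodic_eq_nth)

lemma code_less: "length z = n \<Longrightarrow> code z < 2 ^ (n + 1)"
  using code_bounds(2)[of z] by simp

definition coeff_bits :: "bit poly \<Rightarrow> bool list" where
  "coeff_bits f = map (\<lambda>i. coeff f i = 1) [0..<Suc (degree f)]"

lemma length_coeff_bits [simp]: "length (coeff_bits f) = Suc (degree f)"
  by (simp add: coeff_bits_def)

lemma Poly_coeff_bits [simp]: "Poly (map of_bool (coeff_bits f)) = f"
  by (rule poly_eqI)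
    (auto simp: coeff_bits_def nth_default_def coeff_eq_0 simp del: upt_Suc simp flip: bit_eq_of_bool)

text \<open>
  The search succeeds because the codeword passes the test, and it finds nothing else because a
  solution of the recurrence is determined by its initial values.
\<close>

lemma generate_code:
  fixes m n :: nat
  assumes f: "primitive_poly f" "degree f = m" and c: "c \<in> golomb_sequences f" and n: "n = 2 ^ m - 1" "n > 0"
  shows "generate_code (code (coeff_bits f @ take m (encode_word c))) = code (encode_word c)"
proof -
  have len: "length c = n" using filter_seq_golomb(1)[OF f(1) c] f(2) n(1) by simp
  have kill: "filter_seq f (periodic c) = (\<lambda>_. 0)" by (rule filter_seq_golomb(2)[OF f(1) c])
  have mn: "m \<le> n" using less_exp[of m] unfolding n(1) by linarith
  let ?p = "coeff_bits f @ take m (encode_word c)"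
  let ?P = "\<lambda>W. code_length W = n \<and> recurrence_holds m n (code ?p) W \<and>
     (\<forall>i<m. code_digit W i \<longleftrightarrow> code_digit (code ?p) (Suc m + i))"
  have lp: "length ?p = Suc (2 * m)" using f(2) len mn by simp
  have rec: "recurrence_holds m n (code ?p) (code (encode_word d)) \<longleftrightarrow> filter_seq f (periodic d) = (\<lambda>_. 0)"
    if "length d = n" for d
    using recurrence_holds_iff[OF that n(2), of m ?p] lp f(2) by simp
  have init: "code_digit (code ?p) (Suc m + i) \<longleftrightarrow> periodic c (int i) = 1" if "i < m" for i
    using that lp f(2) mn len by (simp add: nth_append periodic_eq_nth) (simp add: encode_word_def)
  have "?P (code (encode_word c))"
    using rec[OF len] kill init len mn by (auto simp: nth_encode_word)
  moreover have "code (encode_word c) < 2 ^ (n + 1)" using len by (intro code_less) simp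
  ultimately have P: "?P (generated_code m n (code ?p))"
    unfolding generated_code_def by (rule least_below(1)[where P = ?P])
  obtain d where d: "generated_code m n (code ?p) = code (encode_word d)" "length d = n"
    using word_of_code[of "generated_code m n (code ?p)"] P by metis
  have init_eq: "periodic c (int i) = periodic d (int i)" if "i < m" for i
  proof -
    have "periodic d (int i) = 1 \<longleftrightarrow> periodic c (int i) = 1"
      using P that init[OF that] mn d by (auto simp: nth_encode_word)
    then show ?thesis by (metis bit_not_one_iff)
  qed
  have "filter_seq f (periodic d) = (\<lambda>_. 0)" using P rec[OF d(2)] d(1) by metis
  then have "periodic c (int k) = periodic d (int k)" for k
    using recurrence_initial_values[OF primitive_coeff_0[OF f(1)] f(2) kill _ init_eq] by blast
  then have "c = d" using len d(2) by (intro periodic_determines) simp_all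
  then show ?thesis using lp d(1) n(1) by (simp add: generate_code_def)
qed

lemma side_square:
  assumes "code_length N = n * n"
  shows "side N = n"
  unfolding side_def assms
proof (rule least_below_eq)
  show "n < n * n + 1" by (cases n) auto
  show "\<not> n * n \<le> i * i" if "i < n" for i
    using that mult_strict_mono'[of i n i n] by simp
qed simp

lemma side_degree_eq:
  assumes "side N = 2 ^ m - 1"
  shows "side_degree N = m"
  unfolding side_degree_def assms
proof (rule least_below_eq)
  show "m < 2 ^ m - 1 + 1" using less_exp[of m] by simp
  show "\<not> 2 ^ m - 1 < (2 :: nat) ^ i" if "i < m" for i
  proof -
    have "(2 :: nat) ^ Suc i \<le> 2 ^ m" using that by (intro power_increasing) auto
    moreover have "(1 :: nat) \<le> 2 ^ i" by simp
    ultimately show ?thesis by simp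
  qed
qed simp

text \<open>
  The codeword is a candidate, so the search ends with some candidate, and every candidate meets the
  assumptions of \<open>reversal_sum_determines\<close>.
\<close>

lemma recovered_code:
  assumes f: "primitive_poly f" "degree f = m" "m \<ge> 3" and c: "c \<in> golomb_sequences f"
  defines "N \<equiv> code (sign_pattern (golomb_matrix c))"
  shows "recovered_code N = code (encode_word c) \<or> recovered_reversed_code N = code (encode_word c)"
proof -
  define n where "n = length c"
  have n: "n = 2 ^ m - 1" using filter_seq_golomb(1)[OF f(1) c] f(2) by (simp add: n_def)
  have "(2 :: nat) ^ 3 \<le> 2 ^ m" using f(3) by (intro power_increasing) auto
  then have n0: "n > 0" by (simp add: n)
  have pattern: "sign_pattern (golomb_matrix c) = map (\<lambda>k. (periodic c (int (k div n) - int (k mod n)) = 1) \<noteq>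
      (periodic c (int (k mod n) - int (k div n)) = 1)) [0..<n * n]"
    by (rule sign_pattern_golomb_matrix) (use n0 in \<open>auto simp: n_def\<close>)
  then have "length (sign_pattern (golomb_matrix c)) = n * n" by simp
  then have side: "side N = n" and deg: "side_degree N = m"
    using side_square[of N n] side_degree_eq[of N m] n by (auto simp: N_def)
  have row: "code_digit N j \<longleftrightarrow> (periodic c (- int j) = 1) \<noteq> (periodic c (int j) = 1)" if "j < n" for j
  proof -
    have "j < n * n" using that n0 by (metis less_le_trans mult.right_neutral mult_le_mono2 Suc_leI One_nat_def)
    then show ?thesis using that pattern by (simp add: N_def)
  qed
  have mirror: "code_digit (code (encode_word d)) ((n - j) mod n) \<longleftrightarrow> periodic d (- int j) = 1"
    if "length d = n" "j \<le> n" for d j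
  proof -
    have "int (n - j) = - int j + int n" using that by (simp add: of_nat_diff)
    then have "int (n - j) mod int (length d) = (- int j) mod int (length d)"
      unfolding that(1) by (simp only: mod_add_self2)
    then show ?thesis using code_digit_word_mod[of d "n - j" "- int j"] that(1) n0 by simp
  qed
  have kill: "filter_seq f (periodic c) = (\<lambda>_. 0)" "periodic c \<noteq> (\<lambda>_. 0)"
    using filter_seq_golomb[OF f(1) c] by auto
  have "code (coeff_bits f) < 2 ^ (m + 2)"
    using code_less[of "coeff_bits f" "m + 1"] f(2) by simp
  moreover have "coeff_bits f ! 0"
    using primitive_coeff_0[OF f(1)] by (simp add: coeff_bits_def nth_append del: upt_Suc)
  then have "\<exists>i<Suc m. code_digit (code (coeff_bits f)) i"
    using f(2) by (intro exI[of _ 0]) simp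
  moreover have "recurrence_holds m n (code (coeff_bits f)) (code (encode_word c))"
    using recurrence_holds_iff[of c n m "coeff_bits f"] n0 f(2) kill by (simp add: n_def)
  moreover have "code_digit N j \<longleftrightarrow>
      code_digit (code (encode_word c)) j \<noteq> code_digit (code (encode_word c)) ((n - j) mod n)" if "j < n" for j
    using that row[OF that] mirror[of c j] code_digit_word[of j c] by (auto simp: n_def)
  ultimately have "candidate m n N (code (encode_word c))"
    using f(2) unfolding candidate_def by (auto simp: n_def)
  moreover have "code (encode_word c) < 2 ^ (n + 1)" by (intro code_less) (simp add: n_def)
  ultimately have cand: "candidate m n N (recovered_code N)"
    unfolding recovered_code_def side deg by (rule least_below(1))
  then have lenW: "code_length (recovered_code N) = n" by (simp add: candidate_def)
  obtain d where d: "recovered_code N = code (encode_word d)" "length d = n"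
    using word_of_code[of "recovered_code N"] lenW by metis
  obtain F where F: "\<exists>i<Suc m. code_digit F i" "code_length F = Suc m"
    "recurrence_holds m n F (code (encode_word d))"
    using cand d by (auto simp: candidate_def)
  obtain z where z: "code z = F" using code_surj by blast
  define g :: "bit poly" where "g = Poly (map of_bool z)"
  have lz: "length z = Suc m" using F(2) z by auto
  have g_coeff: "coeff g i = (if i < Suc m then of_bool (z ! i) else 0)" for i
    by (simp add: g_def nth_default_def lz)
  have "g \<noteq> 0"
  proof -
    obtain i where "i < Suc m" "z ! i" using F(1) lz z by auto
    then have "coeff g i = 1" by (simp add: g_coeff)
    then show ?thesis by auto
  qed
  moreover have "degree g \<le> degree f"
    unfolding f(2) by (rule degree_le) (simp add: g_coeff)
  moreover have "filter_seq g (periodic d) = (\<lambda>_. 0)"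
    using recurrence_holds_iff[OF d(2) n0, of m z] F(3) z lz by (simp add: g_def)
  moreover have "periodic d j + periodic d (- j) = periodic c j + periodic c (- j)" for j
  proof -
    define k where "k = nat (j mod int n)"
    have k: "int k = j mod int n" "k < n" using n0 by (auto simp: k_def nat_less_iff)
    have p: "periodic e j = periodic e (int k)" "periodic e (- j) = periodic e (- int k)" if "length e = n" for e
      using that k by (auto intro!: periodic_cong simp: mod_minus_eq)
    have "code_digit N k \<longleftrightarrow> (periodic d (int k) = 1) \<noteq> (periodic d (- int k) = 1)"
      using cand k(2) d mirror[of d k] code_digit_word[of k d] by (simp add: candidate_def)
    then have "(periodic d (int k) = 1) \<noteq> (periodic d (- int k) = 1) \<longleftrightarrow>
        (periodic c (int k) = 1) \<noteq> (periodic c (- int k) = 1)"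
      using row[OF k(2)] by auto
    then have "periodic d (int k) + periodic d (- int k) = periodic c (int k) + periodic c (- int k)"
      by (cases "periodic d (int k)"; cases "periodic d (- int k)"; cases "periodic c (int k)";
          cases "periodic c (- int k)") simp_all
    then show ?thesis using p[OF d(2)] p[of c] by (simp add: n_def)
  qed
  ultimately have "periodic d = periodic c \<or> periodic d = (\<lambda>j. periodic c (- j))"
    using f kill by (intro reversal_sum_determines[of f _ g]) auto
  then show ?thesis
  proof
    assume "periodic d = periodic c"
    then have "d = c" using d(2) by (intro periodic_determines) (auto simp: n_def)
    then show ?thesis using d(1) by simp
  next
    assume *: "periodic d = (\<lambda>j. periodic c (- j))"
    have "map (\<lambda>i. code_digit (code (encode_word d)) ((n - i) mod n)) [0..<n] = encode_word c"
    proof (rule nth_equalityI)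
      fix i assume "i < length (map (\<lambda>i. code_digit (code (encode_word d)) ((n - i) mod n)) [0..<n])"
      then have i: "i < n" by simp
      then have "code_digit (code (encode_word d)) ((n - i) mod n) \<longleftrightarrow> encode_word c ! i"
        using mirror[OF d(2), of i] nth_encode_word[of i c] * by (simp add: n_def)
      with i show "map (\<lambda>i. code_digit (code (encode_word d)) ((n - i) mod n)) [0..<n] ! i = encode_word c ! i"
        by simp
    qed (simp add: n_def)
    then show ?thesis by (simp add: recovered_reversed_code_def reversed_code_def side d(1))
  qed
qed

section \<open>Complexity\<close>

lemma KC_le: "computes U p (binary n) y \<Longrightarrow> KC U y n \<le> length p"
  unfolding KC_def by (rule Least_le) blast

lemma KC_program:
  assumes "computes U p (binary n) y"
  obtains q where "length q = KC U y n" "computes U q (binary n) y"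
  using LeastI[of "\<lambda>l. \<exists>p. length p = l \<and> computes U p (binary n) y" "length p"] assms
  unfolding KC_def by blast

text \<open>
  The constant is the length of the description of the machine that runs \<open>U\<close> and then computes \<open>F\<close>.
\<close>

lemma KC_post_process:
  assumes U: "universal_tm U" and F: "prim (\<lambda>e. F (e 0))"
  obtains C where "\<And>p n y z. computes U p (binary n) y \<Longrightarrow> F (code y) = code z \<Longrightarrow>
    (\<exists>q. computes U q (binary n) z) \<and> KC U z n \<le> KC U y n + C"
proof -
  have wf: "wf_tm U" using U by (simp add: universal_tm_def)
  then have "2 < num_tapes U" by (simp add: wf_tm_def)
  from post_process[OF wf this F] obtain M where M: "wf_tm M"
    and run: "\<And>p x y z k ts. (tm_step U ^^ k) (initial_config U p x) = (num_states U, ts) \<Longrightarrow>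
      spells (ts ! 2) y \<Longrightarrow> F (code y) = code z \<Longrightarrow> computes M p x z"
    by blast
  obtain w where w: "\<And>p x y. computes U (w @ p) x y \<longleftrightarrow> computes M p x y"
    using U M unfolding universal_tm_def by blast
  show ?thesis
  proof (rule that)
    fix p n y z assume y: "computes U p (binary n) y" and z: "F (code y) = code z"
    obtain q where q: "length q = KC U y n" "computes U q (binary n) y" by (rule KC_program[OF y])
    then have "computes M q (binary n) z"
      using run z unfolding computes_def by blast
    then have "computes U (w @ q) (binary n) z" using w by blast
    moreover from KC_le[OF this] have "KC U z n \<le> KC U y n + length w" using q(1) by simp
    ultimately show "(\<exists>q. computes U q (binary n) z) \<and> KC U z n \<le> KC U y n + length w" by blast
  qed
qed

text \<open>
  A machine without active states halts at once and leaves its program on tape 0, where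
  post-processing picks it up.
\<close>

lemma KC_of_program:
  assumes U: "universal_tm U" and F: "prim (\<lambda>e. F (e 0))"
  obtains w where "\<And>p n z. F (code p) = code z \<Longrightarrow> computes U (w @ p) (binary n) z"
proof -
  define I where "I = \<lparr>num_tapes = 3, num_symbols = 3, num_states = 0, trans = (\<lambda>q rs. (0, []))\<rparr>"
  have "wf_tm I" "0 < num_tapes I" by (auto simp: I_def wf_tm_def)
  from post_process[OF this F] obtain M where M: "wf_tm M"
    and run: "\<And>p x y z k ts. (tm_step I ^^ k) (initial_config I p x) = (num_states I, ts) \<Longrightarrow>
      spells (ts ! 0) y \<Longrightarrow> F (code y) = code z \<Longrightarrow> computes M p x z"
    by blast
  obtain w where w: "\<And>p x y. computes U (w @ p) x y \<longleftrightarrow> computes M p x y"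
    using U M unfolding universal_tm_def by blast
  show ?thesis
  proof (rule that)
    fix p n z assume z: "F (code p) = code z"
    have "(tm_step I ^^ 0) (initial_config I p (binary n)) = (num_states I, snd (initial_config I p (binary n)))"
      by (simp add: initial_config_def I_def)
    moreover have "spells (snd (initial_config I p (binary n)) ! 0) p"
      by (simp add: initial_config_def spells_def string_tape_def)
    ultimately show "computes U (w @ p) (binary n) z"
      using run z w by blast
  qed
qed

lemma log_asymp:
  fixes c' :: "nat \<Rightarrow> real"
  assumes "\<And>n. \<bar>c' n\<bar> \<le> C"
  shows "(\<lambda>n. 2 * log 2 (real n + 1) - 1 + c' n) \<sim>[at_top] (\<lambda>n. 2 * log 2 (real n))"
proof -
  have "(\<lambda>n. c' n - 1) \<in> O(\<lambda>_. 1 :: real)"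
  proof (rule bigoI[where c = "C + 1"])
    have "\<bar>c' n - 1\<bar> \<le> C + 1" for n using assms[of n] by linarith
    then show "\<forall>\<^sub>F n in at_top. norm (c' n - 1) \<le> (C + 1) * norm (1 :: real)" by simp
  qed
  moreover have "(\<lambda>_. 1 :: real) \<in> o(\<lambda>n. 2 * log 2 (real n))" by real_asymp
  ultimately have "(\<lambda>n. c' n - 1) \<in> o(\<lambda>n. 2 * log 2 (real n))"
    by (rule landau_o.big_small_trans)
  moreover have "(\<lambda>n. 2 * log 2 (real n + 1)) \<sim>[at_top] (\<lambda>n. 2 * log 2 (real n))" by real_asymp
  ultimately have "(\<lambda>n. 2 * log 2 (real n + 1) + (c' n - 1)) \<sim>[at_top] (\<lambda>n. 2 * log 2 (real n))"
    by (simp only: asymp_equiv_add_right)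
  then show ?thesis by (simp add: algebra_simps)
qed

theorem proposition3:
  fixes U :: tm
  assumes "universal_tm U"
  shows "\<exists>C :: real.
    (\<forall>(m :: nat) (n :: nat) (f :: bit poly) (\<phi> :: bit list).
       m \<ge> 1 \<and> n = 2 ^ m - 1 \<and> primitive_poly f \<and> degree f = m \<and> \<phi> \<in> golomb_sequences f \<longrightarrow>
       (\<exists>c c' :: real. \<bar>c\<bar> \<le> C \<and> \<bar>c'\<bar> \<le> C \<and>
          real (KC U (sign_pattern (golomb_matrix \<phi>)) n) = real (KC U (encode_word \<phi>) n) + c \<and>
          real (KC U (encode_word \<phi>) n) + c \<le> 2 * log 2 (real n + 1) - 1 + c')) \<and>
    (\<forall>c' :: nat \<Rightarrow> real. (\<forall>n. \<bar>c' n\<bar> \<le> C) \<longrightarrow>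
       (\<lambda>n. 2 * log 2 (real n + 1) - 1 + c' n) \<sim>[at_top] (\<lambda>n. 2 * log 2 (real n)))"
proof -
  obtain w where generate: "\<And>p n z. generate_code (code p) = code z \<Longrightarrow> computes U (w @ p) (binary n) z"
    using KC_of_program[OF assms prim_generate_code] by blast
  obtain C1 where C1: "\<And>p n y z. computes U p (binary n) y \<Longrightarrow> sign_code (code y) = code z \<Longrightarrow>
      (\<exists>q. computes U q (binary n) z) \<and> KC U z n \<le> KC U y n + C1"
    using KC_post_process[OF assms prim_sign_code] by blast
  obtain C2 where C2: "\<And>p n y z. computes U p (binary n) y \<Longrightarrow> recovered_code (code y) = code z \<Longrightarrow>
      (\<exists>q. computes U q (binary n) z) \<and> KC U z n \<le> KC U y n + C2"
    using KC_post_process[OF assms prim_recovered_code] by blast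
  obtain C3 where C3: "\<And>p n y z. computes U p (binary n) y \<Longrightarrow> recovered_reversed_code (code y) = code z \<Longrightarrow>
      (\<exists>q. computes U q (binary n) z) \<and> KC U z n \<le> KC U y n + C3"
    using KC_post_process[OF assms prim_recovered_reversed_code] by blast
  \<comment> \<open>The summand 5 covers \<open>2 * m + 1\<close> for \<open>m \<le> 2\<close>, and the difference 2 between \<open>2 * m + 1\<close> and
    \<open>2 * m - 1\<close>.\<close>
  define C where "C = real (length w + C1 + C2 + C3 + 5)"
  have main: "\<exists>c c' :: real. \<bar>c\<bar> \<le> C \<and> \<bar>c'\<bar> \<le> C \<and>
      real (KC U (sign_pattern (golomb_matrix \<phi>)) n) = real (KC U (encode_word \<phi>) n) + c \<and>
      real (KC U (encode_word \<phi>) n) + c \<le> 2 * log 2 (real n + 1) - 1 + c'"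
    if m: "m \<ge> 1" and n: "n = 2 ^ m - 1" and f: "primitive_poly f" "degree f = m"
      and \<phi>: "\<phi> \<in> golomb_sequences f" for m n f \<phi>
  proof -
    let ?y = "encode_word \<phi>" and ?z = "sign_pattern (golomb_matrix \<phi>)"
    have "(2 :: nat) ^ 1 \<le> 2 ^ m" using m by (intro power_increasing) auto
    then have n0: "n > 0" by (simp add: n)
    have len: "length \<phi> = n" using filter_seq_golomb(1)[OF f(1) \<phi>] f(2) n by simp
    have mn: "m \<le> n" using less_exp[of m] unfolding n by linarith
    let ?p = "coeff_bits f @ take m ?y"
    have y: "computes U (w @ ?p) (binary n) ?y"
      by (rule generate[OF generate_code[OF f \<phi> n n0]])
    have Ky: "KC U ?y n \<le> 2 * m + 1 + length w"
      using KC_le[OF y] f(2) len mn by simp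
    have sign: "sign_code (code ?y) = code ?z" using sign_code[of \<phi>] len n0 by simp
    obtain q where q: "computes U q (binary n) ?z" and Kz: "KC U ?z n \<le> KC U ?y n + C1"
      using C1[OF y sign] by blast
    have Ky_le: "KC U ?y n \<le> KC U ?z n + (length w + C2 + C3 + 5)"
    proof (cases "m \<ge> 3")
      case True
      from recovered_code[OF f True \<phi>] C2[OF q, of ?y] C3[OF q, of ?y] show ?thesis by auto
    next
      case False
      then show ?thesis using Ky by simp
    qed
    have log: "log 2 (real n + 1) = real m"
      by (simp add: n of_nat_diff)
    show ?thesis
      by (rule exI[of _ "real (KC U ?z n) - real (KC U ?y n)"], rule exI[of _ C])
        (use Ky Kz Ky_le in \<open>simp add: log C_def\<close>)
  qed
  then show ?thesis
    using log_asymp by (intro exI[of _ C]) blast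
qed

end
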